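(* Let $K$ be an algebraically closed field, $r\ge2$ and $L\ge1$ integers, $Q$ the quiver with one vertex and $r$ loops, and $\Lambda=KQ/\langle\text{all paths of length }L+1\rangle$, with Jacobson radical $J$. Suppose $d>L+1$, and let $\mathcal C$ be an irreducible component of $\mathbf{Rep}_d(\Lambda)$. Then the modules $M$ in $\mathcal C$ generically satisfy the following condition: $J^Lx\ne0$ whenever $x\in M\setminus JM$. In particular: There exists a dense open subset $\mathfrak U\subseteq\mathcal C$ such that every module in $\mathfrak U$ has a decomposition into indecomposable direct summands all of which have Loewy length $L+1$.
   Context: Modules are finite dimensional left $\Lambda$-modules. $\mathbf{Rep}_d(\Lambda)$ is the affine variety of $r$-tuples $(A_1,\dots,A_r)$ of $d\times d$ matrices over $K$ such that all $(L+1)$-fold products of the $A_i$ vanish; a point $x=(A_i)$ corresponds to the module $M_x$ on $K^d$ on which the $i$-th loop acts as $A_i$. The modules in a subset of $\mathbf{Rep}_d(\Lambda)$ are the $M_x$ for $x$ in that subset (up to isomorphism). The modules in an irreducible subset generically satisfy a condition if all modules in some dense open subset of it do. The Loewy length of $M$ is the least $m$ with $J^mM=0$. *)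

theory Defs
  imports
    "HOL-Analysis.Analysis"
    "HOL-Library.Poly_Mapping"
    "HOL-Computational_Algebra.Polynomial"
    "HOL-Algebra.Ideal_Product"
    "HOL-Algebra.QuotRing"
begin

section \<open>The truncated path algebra of the quiver with one vertex\<close>

text \<open>
  The loops are the elements of a finite type \<open>'r\<close>, so a path is a word in them. The library
  writes the monoid operation of a monoid algebra additively; here it is the (noncommutative)
  concatenation of paths, and the monoid algebra is \<open>KQ\<close>.
\<close>

datatype 'r quiver_path = Path (arrows: "'r list")

instantiation quiver_path :: (type) monoid_add
begin

definition zero_quiver_path :: "'a quiver_path" where
  "0 = Path []"

definition plus_quiver_path :: "'a quiver_path \<Rightarrow> 'a quiver_path \<Rightarrow> 'a quiver_path" where
  "p + q = Path (arrows p @ arrows q)"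

instance
  by standard (simp_all add: zero_quiver_path_def plus_quiver_path_def)

end

definition path_algebra :: "('r quiver_path \<Rightarrow>\<^sub>0 'k::field) ring" where
  "path_algebra =
     \<lparr>carrier = UNIV, monoid.mult = (*), one = 1, ring.zero = 0, add = (+)\<rparr>"

definition path_ideal :: "nat \<Rightarrow> ('r quiver_path \<Rightarrow>\<^sub>0 'k::field) set" where
  "path_ideal n =
     genideal path_algebra {Poly_Mapping.single p 1 | p. length (arrows p) = n}"

definition truncated_path_algebra ::
    "nat \<Rightarrow> ('r quiver_path \<Rightarrow>\<^sub>0 'k::field) set ring" where
  "truncated_path_algebra L = FactRing path_algebra (path_ideal (L + 1))"


section \<open>Jacobson radical\<close>

definition left_ideal :: "'a set \<Rightarrow> ('a, 'b) ring_scheme \<Rightarrow> bool" where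
  "left_ideal I R \<longleftrightarrow>
     additive_subgroup I R \<and> (\<forall>a\<in>carrier R. \<forall>x\<in>I. a \<otimes>\<^bsub>R\<^esub> x \<in> I)"

definition maximal_left_ideal :: "'a set \<Rightarrow> ('a, 'b) ring_scheme \<Rightarrow> bool" where
  "maximal_left_ideal I R \<longleftrightarrow>
     left_ideal I R \<and> I \<noteq> carrier R \<and>
     (\<forall>I'. left_ideal I' R \<and> I \<subseteq> I' \<longrightarrow> I' = I \<or> I' = carrier R)"

definition jacobson_radical :: "('a, 'b) ring_scheme \<Rightarrow> 'a set" where
  "jacobson_radical R = carrier R \<inter> \<Inter>{I. maximal_left_ideal I R}"

definition rad :: "nat \<Rightarrow> ('r quiver_path \<Rightarrow>\<^sub>0 'k::field) set set" where
  "rad L = jacobson_radical (truncated_path_algebra L)"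

definition rad_power :: "nat \<Rightarrow> nat \<Rightarrow> ('r quiver_path \<Rightarrow>\<^sub>0 'k::field) set set" where
  "rad_power L m = rad L [^]\<^bsub>ideals_set (truncated_path_algebra L)\<^esub> m"


section \<open>Representations and their modules\<close>

definition path_matrix :: "'k::field^'n^'n^'r \<Rightarrow> 'r quiver_path \<Rightarrow> 'k^'n^'n" where
  "path_matrix x p = foldr (\<lambda>i B. x $ i ** B) (arrows p) (mat 1)"

definition rep_variety :: "nat \<Rightarrow> ('k::field^'n^'n^'r) set" where
  "rep_variety L = {x. \<forall>p. length (arrows p) = L + 1 \<longrightarrow> path_matrix x p = 0}"

definition path_algebra_act ::
    "'k::field^'n^'n^'r \<Rightarrow> ('r quiver_path \<Rightarrow>\<^sub>0 'k) \<Rightarrow> 'k^'n \<Rightarrow> 'k^'n" where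
  "path_algebra_act x f v =
     (\<Sum>p\<in>Poly_Mapping.keys f. Poly_Mapping.lookup f p *s (path_matrix x p *v v))"

text \<open>
  The module \<open>M\<^sub>x\<close> is the whole type \<open>'k^'n\<close>, on which an element of the truncated path algebra,
  that is a coset, acts through any of its representatives; lemma \<open>act_coset\<close> below shows that
  for \<open>x\<close> in the representation variety the choice does not matter.
\<close>

definition act ::
    "'k::field^'n^'n^'r \<Rightarrow> ('r quiver_path \<Rightarrow>\<^sub>0 'k) set \<Rightarrow> 'k^'n \<Rightarrow> 'k^'n" where
  "act x a v = path_algebra_act x (SOME f. f \<in> a) v"

definition submodule :: "nat \<Rightarrow> 'k::field^'n^'n^'r \<Rightarrow> ('k^'n) set \<Rightarrow> bool" where
  "submodule L x N \<longleftrightarrow>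
     vec.subspace N \<and> (\<forall>a\<in>carrier (truncated_path_algebra L). \<forall>v\<in>N. act x a v \<in> N)"

text \<open>The submodule \<open>IN\<close>. For an ideal \<open>I\<close> the additive and the linear span agree.\<close>

definition ideal_smult ::
    "'k::field^'n^'n^'r \<Rightarrow> ('r quiver_path \<Rightarrow>\<^sub>0 'k) set set \<Rightarrow> ('k^'n) set \<Rightarrow> ('k^'n) set" where
  "ideal_smult x I N = vec.span {act x a v | a v. a \<in> I \<and> v \<in> N}"

definition loewy_length :: "nat \<Rightarrow> 'k::field^'n^'n^'r \<Rightarrow> ('k^'n) set \<Rightarrow> nat" where
  "loewy_length L x N = (LEAST m. ideal_smult x (rad_power L m) N = {0})"

definition indecomposable :: "nat \<Rightarrow> 'k::field^'n^'n^'r \<Rightarrow> ('k^'n) set \<Rightarrow> bool" where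
  "indecomposable L x N \<longleftrightarrow>
     submodule L x N \<and> N \<noteq> {0} \<and>
     \<not> (\<exists>A B. submodule L x A \<and> submodule L x B \<and> A \<noteq> {0} \<and> B \<noteq> {0} \<and>
            A \<inter> B = {0} \<and> {a + b | a b. a \<in> A \<and> b \<in> B} = N)"

definition decomposition ::
    "nat \<Rightarrow> 'k::field^'n^'n^'r \<Rightarrow> nat \<Rightarrow> (nat \<Rightarrow> ('k^'n) set) \<Rightarrow> bool" where
  "decomposition L x k N \<longleftrightarrow>
     (\<forall>i<k. submodule L x (N i)) \<and>
     (\<forall>v. \<exists>!u. (\<forall>i<k. u i \<in> N i) \<and> (\<forall>i\<ge>k. u i = 0) \<and> v = (\<Sum>i<k. u i))"


section \<open>Zariski topology\<close>

inductive_set polynomial_functions :: "('k::field^'n^'n^'r \<Rightarrow> 'k) set" where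
  const: "(\<lambda>x. c) \<in> polynomial_functions"
| coord: "(\<lambda>x. x $ i $ a $ b) \<in> polynomial_functions"
| add: "p \<in> polynomial_functions \<Longrightarrow> q \<in> polynomial_functions \<Longrightarrow>
    (\<lambda>x. p x + q x) \<in> polynomial_functions"
| mult: "p \<in> polynomial_functions \<Longrightarrow> q \<in> polynomial_functions \<Longrightarrow>
    (\<lambda>x. p x * q x) \<in> polynomial_functions"

definition zero_locus :: "('k::field^'n^'n^'r \<Rightarrow> 'k) set \<Rightarrow> ('k^'n^'n^'r) set" where
  "zero_locus P = {x. \<forall>p\<in>P. p x = 0}"

definition zariski :: "('k::field^'n^'n^'r) topology" where
  "zariski = topology (\<lambda>U. \<exists>P\<subseteq>polynomial_functions. U = - zero_locus P)"

definition irreducible_in :: "'a topology \<Rightarrow> 'a set \<Rightarrow> bool" where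
  "irreducible_in T S \<longleftrightarrow>
     S \<subseteq> topspace T \<and> S \<noteq> {} \<and>
     (\<forall>A B. closedin T A \<and> closedin T B \<and> S \<subseteq> A \<union> B \<longrightarrow> S \<subseteq> A \<or> S \<subseteq> B)"

definition irreducible_component :: "'a topology \<Rightarrow> 'a set \<Rightarrow> bool" where
  "irreducible_component T C \<longleftrightarrow>
     irreducible_in T C \<and> (\<forall>D. irreducible_in T D \<and> C \<subseteq> D \<longrightarrow> D = C)"

definition dense_open_in :: "'a topology \<Rightarrow> 'a set \<Rightarrow> bool" where
  "dense_open_in T U \<longleftrightarrow> openin T U \<and> T closure_of U = topspace T"

definition generically :: "('k::field^'n^'n^'r) set \<Rightarrow> ('k^'n^'n^'r \<Rightarrow> bool) \<Rightarrow> bool" where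
  "generically C P \<longleftrightarrow> (\<exists>U. dense_open_in (subtopology zariski C) U \<and> (\<forall>x\<in>U. P x))"


section \<open>Basic facts\<close>

lemma istopology_zariski:
  "istopology (\<lambda>U. \<exists>P\<subseteq>polynomial_functions. U = - zero_locus (P :: ('k::field^'n^'n^'r \<Rightarrow> 'k) set))"
  unfolding istopology_def
proof (intro conjI allI impI)
  fix S T :: "('k^'n^'n^'r) set"
  assume "\<exists>P\<subseteq>polynomial_functions. S = - zero_locus P"
    and "\<exists>P\<subseteq>polynomial_functions. T = - zero_locus P"
  then obtain P Q where P: "P \<subseteq> polynomial_functions" "S = - zero_locus P"
    and Q: "Q \<subseteq> polynomial_functions" "T = - zero_locus Q"
    by auto
  define R where "R = {\<lambda>x. p x * q x | p q. p \<in> P \<and> q \<in> Q}"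
  have "R \<subseteq> polynomial_functions"
    using P(1) Q(1) by (auto simp: R_def intro!: polynomial_functions.mult)
  moreover have "S \<inter> T = - zero_locus R"
    unfolding P(2) Q(2) R_def zero_locus_def by fastforce
  ultimately show "\<exists>P\<subseteq>polynomial_functions. S \<inter> T = - zero_locus P"
    by blast
next
  fix \<K> :: "('k^'n^'n^'r) set set"
  assume "\<forall>K\<in>\<K>. \<exists>P\<subseteq>polynomial_functions. K = - zero_locus P"
  then obtain P where P: "\<And>K. K \<in> \<K> \<Longrightarrow> P K \<subseteq> polynomial_functions \<and> K = - zero_locus (P K)"
    by metis
  have "\<Union>\<K> = - zero_locus (\<Union>(P ` \<K>))"
  proof -
    have "\<Union>\<K> = (\<Union>K\<in>\<K>. - zero_locus (P K))"
      using P by (metis (no_types, lifting) SUP_cong SUP_identity_eq)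
    also have "\<dots> = - zero_locus (\<Union>(P ` \<K>))"
      by (auto simp: zero_locus_def)
    finally show ?thesis .
  qed
  then show "\<exists>P\<subseteq>polynomial_functions. \<Union>\<K> = - zero_locus P"
    using P by (intro exI[of _ "\<Union>(P ` \<K>)"]) blast
qed

lemma openin_zariski:
  "openin zariski U \<longleftrightarrow> (\<exists>P\<subseteq>polynomial_functions. U = - zero_locus P)"
  unfolding zariski_def by (simp add: topology_inverse'[OF istopology_zariski])

lemma topspace_zariski [simp]: "topspace zariski = UNIV"
proof -
  have "openin zariski (UNIV :: ('a::field^'b^'b^'c) set)"
    unfolding openin_zariski zero_locus_def
    by (rule exI[of _ "{\<lambda>x. 1}"]) (auto intro: polynomial_functions.const)
  then show ?thesis
    using openin_subset by blast
qed

lemma closedin_zariski: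
  "closedin zariski S \<longleftrightarrow> (\<exists>P\<subseteq>polynomial_functions. S = zero_locus P)"
  by (metis Compl_eq_Diff_UNIV closedin_def double_compl openin_zariski subset_UNIV topspace_zariski)

lemma ring_path_algebra: "ring path_algebra"
proof -
  have "\<exists>g. f + g = 0" for f :: "'a quiver_path \<Rightarrow>\<^sub>0 'b"
    by (rule exI[of _ "- f"]) simp
  then show ?thesis
    unfolding path_algebra_def
    by unfold_locales (auto simp: algebra_simps Units_def)
qed

lemma ideal_path_ideal: "ideal (path_ideal n) path_algebra"
  unfolding path_ideal_def
  by (rule ring.genideal_ideal[OF ring_path_algebra]) (simp add: path_algebra_def)

lemma ring_truncated_path_algebra: "ring (truncated_path_algebra L)"
  unfolding truncated_path_algebra_def by (rule ideal.quotient_is_ring[OF ideal_path_ideal])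

lemma path_matrix_add: "path_matrix x (p + q) = path_matrix x p ** path_matrix x q"
proof -
  have *: "foldr (\<lambda>i B. x $ i ** B) ps C = foldr (\<lambda>i B. x $ i ** B) ps (mat 1) ** C" for ps C
    by (induction ps) (simp_all add: matrix_mul_assoc)
  show ?thesis
    unfolding path_matrix_def plus_quiver_path_def
    by (simp add: *[of "arrows p" "foldr _ _ _"])
qed

lemma path_algebra_act_zero [simp]: "path_algebra_act x 0 v = 0"
  by (simp add: path_algebra_act_def)

lemma path_algebra_act_single:
  "path_algebra_act x (Poly_Mapping.single p c) v = c *s (path_matrix x p *v v)"
  by (simp add: path_algebra_act_def)

lemma path_algebra_act_one [simp]: "path_algebra_act x 1 v = v"
proof -
  have "path_matrix x 0 = mat 1"
    by (simp add: path_matrix_def zero_quiver_path_def)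
  then show ?thesis
    using path_algebra_act_single[of x 0 1 v] by simp
qed

lemma path_algebra_act_plus:
  "path_algebra_act x (f + g) v = path_algebra_act x f v + path_algebra_act x g v"
  unfolding path_algebra_act_def
  by (rule setsum_keys_plus_distrib) (simp_all add: vec.scale_left_distrib)

lemma path_algebra_act_sum:
  "path_algebra_act x (sum f S) v = (\<Sum>s\<in>S. path_algebra_act x (f s) v)"
  by (induction S rule: infinite_finite_induct) (simp_all add: path_algebra_act_plus)

lemma path_algebra_act_add_right:
  "path_algebra_act x f (v + w) = path_algebra_act x f v + path_algebra_act x f w"
  by (simp add: path_algebra_act_def matrix_vector_right_distrib vec.scale_right_distrib sum.distrib)

lemma path_algebra_act_mult:
  "path_algebra_act x (f * g) v = path_algebra_act x f (path_algebra_act x g v)"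
proof -
  have expand: "h = (\<Sum>p\<in>Poly_Mapping.keys h. Poly_Mapping.single p (Poly_Mapping.lookup h p))"
    for h :: "'c quiver_path \<Rightarrow>\<^sub>0 'a"
    by (rule poly_mapping_eqI)
      (auto simp: lookup_sum lookup_single when_def in_keys_iff)
  have "path_algebra_act x (f * g) v =
      (\<Sum>p\<in>Poly_Mapping.keys f. \<Sum>q\<in>Poly_Mapping.keys g.
        (Poly_Mapping.lookup f p * Poly_Mapping.lookup g q) *s (path_matrix x (p + q) *v v))"
    by (subst expand[of f], subst expand[of g])
      (simp add: sum_product mult_single path_algebra_act_sum path_algebra_act_single)
  also have "\<dots> = path_algebra_act x f (path_algebra_act x g v)"
    by (simp add: path_algebra_act_def path_matrix_add matrix_vector_mul_assoc[symmetric]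
        vec.linear_sum[OF matrix_vector_mul_linear_gen] vector_scalar_commute[symmetric]
        vec.scale_sum_right)
  finally show ?thesis .
qed

lemma path_ideal_act_zero:
  assumes x: "x \<in> rep_variety L" and f: "f \<in> path_ideal (L + 1)"
  shows "path_algebra_act x f v = 0"
proof -
  have zero [simp]: "path_algebra_act x h 0 = 0" for h
    by (simp add: path_algebra_act_def)
  let ?I = "{f. \<forall>v. path_algebra_act x f v = 0}"
  interpret R: ring "path_algebra :: ('c quiver_path \<Rightarrow>\<^sub>0 'a) ring"
    by (rule ring_path_algebra)
  have uminus: "path_algebra_act x (- h) w = 0" if "\<forall>v. path_algebra_act x h v = 0" for h w
    using path_algebra_act_plus[of x h "- h" w] that by simp
  have a_inv: "\<ominus>\<^bsub>path_algebra\<^esub> h = - h" for h :: "'c quiver_path \<Rightarrow>\<^sub>0 'a"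
    by (rule R.minus_equality) (simp_all add: path_algebra_def)
  have "ideal ?I path_algebra"
  proof (rule idealI[OF R.ring_axioms])
    show "subgroup ?I (add_monoid path_algebra)"
    proof (rule R.add.subgroupI)
      show "?I \<noteq> {}"
        using path_algebra_act_zero by blast
    next
      fix a assume "a \<in> ?I"
      then show "\<ominus>\<^bsub>path_algebra\<^esub> a \<in> ?I"
        by (simp add: a_inv uminus)
    qed (auto simp: path_algebra_def path_algebra_act_plus)
  qed (auto simp: path_algebra_def path_algebra_act_mult)
  moreover have "{Poly_Mapping.single p 1 | p. length (arrows p) = L + 1} \<subseteq> ?I"
    using x by (auto simp: rep_variety_def path_algebra_act_single)
  ultimately have "path_ideal (L + 1) \<subseteq> ?I"
    unfolding path_ideal_def genideal_def by blast
  then show ?thesis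
    using f by blast
qed

lemma act_coset:
  assumes x: "x \<in> rep_variety L"
  shows "act x (path_ideal (L + 1) +>\<^bsub>path_algebra\<^esub> f) v = path_algebra_act x f v"
proof -
  let ?a = "path_ideal (L + 1) +>\<^bsub>path_algebra\<^esub> f"
  interpret I: ideal "path_ideal (L + 1)" "path_algebra :: ('c quiver_path \<Rightarrow>\<^sub>0 'a) ring"
    by (rule ideal_path_ideal)
  have "f \<in> ?a"
    by (rule I.a_rcos_self) (simp add: path_algebra_def)
  then have "(SOME g. g \<in> ?a) \<in> ?a"
    by (rule someI)
  then obtain h where "h \<in> path_ideal (L + 1)" "(SOME g. g \<in> ?a) = h + f"
    unfolding a_r_coset_def' by (auto simp: path_algebra_def)
  then show ?thesis
    using path_ideal_act_zero[OF x] by (simp add: act_def path_algebra_act_plus)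
qed

end

theory Submission
  imports Defs
begin

text \<open>
  Every point \<open>x\<close> of the representation variety respects a strict flag
  \<open>V = F\<^sub>0 \<supset> F\<^sub>1 \<supset> \<dots> \<supset> F\<^bsub>L+1\<^esub> = 0\<close>, meaning that each \<open>x\<^sub>i\<close> maps \<open>F\<^sub>l\<close> into \<open>F\<^bsub>l+1\<^esub>\<close>.
  Among these flags, one minimising the sum of the squares of the
  \<open>d\<^sub>l = dim F\<^sub>l/F\<^bsub>l+1\<^esub>\<close> satisfies \<open>d\<^sub>l \<le> r d\<^bsub>l+1\<^esub>\<close> and \<open>d\<^bsub>l+1\<^esub> \<le> r d\<^sub>l\<close>. The points respecting
  some flag of given dimensions form an irreducible set, the conjugates of a linear space of
  strictly triangular block matrices; there are finitely many of these sets, so a component is the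
  closure of one of them. It therefore contains a 0/1 point for which the annihilator of
  \<open>J\<^sup>L\<close> is \<open>JM\<close>, and this equality is an open condition because it amounts to the invertibility
  of some matrix \<open>\<Sum>\<^sub>i x\<^sub>i P\<^sub>i + \<Sum>\<^sub>w Q\<^sub>w x\<^sub>w\<close>, where \<open>w\<close> runs through the paths of length \<open>L\<close>.
  Where it holds, no nonzero direct summand lies in \<open>JM\<close>, so all summands have Loewy length \<open>L + 1\<close>.
\<close>

section \<open>The radical of the truncated path algebra\<close>

definition path_coset :: "nat \<Rightarrow> ('r quiver_path \<Rightarrow>\<^sub>0 'k::field) \<Rightarrow> ('r quiver_path \<Rightarrow>\<^sub>0 'k) set" where
  "path_coset L f = path_ideal (L + 1) +>\<^bsub>path_algebra\<^esub> f"

text \<open>Describing the path ideals by supports turns membership into a condition on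
  coefficients, which the generated ideal hides.\<close>

definition long_part :: "nat \<Rightarrow> ('r quiver_path \<Rightarrow>\<^sub>0 'k::field) set" where
  "long_part m = {f. \<forall>p\<in>Poly_Mapping.keys f. m \<le> length (arrows p)}"

lemma length_arrows_plus: "length (arrows (p + q)) = length (arrows p) + length (arrows q)"
  by (simp add: plus_quiver_path_def)

lemma length_arrows_zero [simp]: "length (arrows 0) = 0"
  by (simp add: zero_quiver_path_def)

lemma arrows_length_0: "length (arrows p) = 0 \<longleftrightarrow> p = 0"
  by (cases p) (simp add: zero_quiver_path_def)

lemma long_part_0 [simp]: "long_part 0 = UNIV"
  by (simp add: long_part_def)

lemma long_part_zero [simp]: "0 \<in> long_part m"
  by (simp add: long_part_def)

lemma long_part_add: "f \<in> long_part m \<Longrightarrow> g \<in> long_part m \<Longrightarrow> f + g \<in> long_part m"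
  using keys_add[of f g] unfolding long_part_def by blast

lemma long_part_mult:
  assumes "f \<in> long_part m" and "g \<in> long_part k"
  shows "f * g \<in> long_part (m + k)"
proof -
  have "m + k \<le> length (arrows p)" if p: "p \<in> Poly_Mapping.keys (f * g)" for p
  proof -
    obtain a b where "p = a + b" "a \<in> Poly_Mapping.keys f" "b \<in> Poly_Mapping.keys g"
      using subsetD[OF keys_mult p] by blast
    then show ?thesis
      using assms unfolding long_part_def by (simp add: length_arrows_plus add_mono)
  qed
  then show ?thesis
    unfolding long_part_def by blast
qed

lemma long_part_mono: "m \<le> k \<Longrightarrow> long_part k \<subseteq> long_part m"
  unfolding long_part_def using le_trans by blast

lemma long_part_1: "f \<in> long_part 1 \<longleftrightarrow> Poly_Mapping.lookup f 0 = 0"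
proof
  show "f \<in> long_part 1 \<Longrightarrow> Poly_Mapping.lookup f 0 = 0"
    unfolding long_part_def by (force simp: in_keys_iff)
  show "Poly_Mapping.lookup f 0 = 0 \<Longrightarrow> f \<in> long_part 1"
    unfolding long_part_def
    by (clarsimp simp: in_keys_iff) (metis arrows_length_0 Suc_leI gr0I)
qed

lemma single_long_part: "length (arrows p) = m \<Longrightarrow> Poly_Mapping.single p c \<in> long_part m"
  by (simp add: long_part_def)

lemma path_algebra_simps:
  "carrier path_algebra = UNIV" "f \<otimes>\<^bsub>path_algebra\<^esub> g = f * g" "f \<oplus>\<^bsub>path_algebra\<^esub> g = f + g"
  "\<one>\<^bsub>path_algebra\<^esub> = 1" "\<zero>\<^bsub>path_algebra\<^esub> = 0"
  by (simp_all add: path_algebra_def)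

lemma a_inv_path_algebra: "\<ominus>\<^bsub>path_algebra\<^esub> f = - (f :: 'r quiver_path \<Rightarrow>\<^sub>0 'k::field)"
proof -
  interpret R: ring "path_algebra :: ('r quiver_path \<Rightarrow>\<^sub>0 'k) ring"
    by (rule ring_path_algebra)
  show ?thesis
    by (rule R.minus_equality) (simp_all add: path_algebra_def)
qed

lemma ideal_long_part: "ideal (long_part m) (path_algebra :: ('r quiver_path \<Rightarrow>\<^sub>0 'k::field) ring)"
proof (rule idealI[OF ring_path_algebra])
  interpret R: ring "path_algebra :: ('r quiver_path \<Rightarrow>\<^sub>0 'k) ring"
    by (rule ring_path_algebra)
  show "subgroup (long_part m) (add_monoid (path_algebra :: ('r quiver_path \<Rightarrow>\<^sub>0 'k) ring))"
  proof (rule R.add.subgroupI)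
    show "long_part m \<noteq> ({} :: ('r quiver_path \<Rightarrow>\<^sub>0 'k) set)"
      using long_part_zero by blast
  next
    fix a :: "'r quiver_path \<Rightarrow>\<^sub>0 'k" assume "a \<in> long_part m"
    then show "\<ominus>\<^bsub>path_algebra\<^esub> a \<in> long_part m"
      by (simp add: a_inv_path_algebra long_part_def)
  qed (auto simp: path_algebra_simps long_part_add)
next
  fix a x :: "'r quiver_path \<Rightarrow>\<^sub>0 'k" assume a: "a \<in> long_part m"
  show "x \<otimes>\<^bsub>path_algebra\<^esub> a \<in> long_part m" "a \<otimes>\<^bsub>path_algebra\<^esub> x \<in> long_part m"
    using long_part_mult[of x 0 a m] long_part_mult[of a m x 0] a by (simp_all add: path_algebra_simps)
qed

text \<open>A path of length at least \<open>m\<close> is its prefix of length \<open>m\<close>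
  times the rest, so every term of an element of \<open>long_part m\<close> lies in the ideal
  generated by the paths of length \<open>m\<close>.\<close>

lemma path_ideal_eq_long_part: "path_ideal m = (long_part m :: ('r quiver_path \<Rightarrow>\<^sub>0 'k::field) set)"
proof
  show "path_ideal m \<subseteq> (long_part m :: ('r quiver_path \<Rightarrow>\<^sub>0 'k) set)"
    unfolding path_ideal_def
    by (rule ring.genideal_minimal[OF ring_path_algebra ideal_long_part]) (auto simp: single_long_part)
next
  interpret I: ideal "path_ideal m" "path_algebra :: ('r quiver_path \<Rightarrow>\<^sub>0 'k) ring"
    by (rule ideal_path_ideal)
  have gen: "Poly_Mapping.single q 1 \<in> (path_ideal m :: ('r quiver_path \<Rightarrow>\<^sub>0 'k) set)"
    if "length (arrows q) = m" for q
    unfolding path_ideal_def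
    by (rule subsetD[OF I.genideal_self]) (use that in \<open>auto simp: path_algebra_simps\<close>)
  have single: "Poly_Mapping.single p c \<in> (path_ideal m :: ('r quiver_path \<Rightarrow>\<^sub>0 'k) set)"
    if "m \<le> length (arrows p)" for p c
  proof -
    define q where "q = Path (take m (arrows p))"
    define s where "s = Path (drop m (arrows p))"
    have "q + s = p" "length (arrows q) = m"
      using that by (auto simp: q_def s_def plus_quiver_path_def)
    then have eq: "Poly_Mapping.single p c = Poly_Mapping.single q 1 * Poly_Mapping.single s c"
      by (simp add: mult_single)
    show ?thesis
      using I.I_r_closed[OF gen[OF \<open>length (arrows q) = m\<close>], of "Poly_Mapping.single s c"]
      by (simp add: eq path_algebra_simps)
  qed
  show "long_part m \<subseteq> (path_ideal m :: ('r quiver_path \<Rightarrow>\<^sub>0 'k) set)"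
  proof
    fix f :: "'r quiver_path \<Rightarrow>\<^sub>0 'k" assume f: "f \<in> long_part m"
    have "(\<Sum>p\<in>S. Poly_Mapping.single p (Poly_Mapping.lookup f p)) \<in> path_ideal m"
      if "finite S" "S \<subseteq> Poly_Mapping.keys f" for S
      using that
    proof (induction S)
      case empty
      have "0 \<in> (path_ideal m :: ('r quiver_path \<Rightarrow>\<^sub>0 'k) set)"
        using additive_subgroup.zero_closed[OF I.is_additive_subgroup] path_algebra_simps(5) by metis
      then show ?case
        by simp
    next
      case (insert p S)
      then have "Poly_Mapping.single p (Poly_Mapping.lookup f p) \<in> path_ideal m"
        using f by (intro single) (auto simp: long_part_def)
      then show ?case
        using additive_subgroup.a_closed[OF I.is_additive_subgroup] insert by (simp add: path_algebra_simps)
    qed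
    moreover have "f = (\<Sum>p\<in>Poly_Mapping.keys f. Poly_Mapping.single p (Poly_Mapping.lookup f p))"
      by (rule poly_mapping_eqI) (auto simp: lookup_sum lookup_single when_def in_keys_iff)
    ultimately show "f \<in> path_ideal m"
      by (metis finite_keys order_refl)
  qed
qed

lemma path_coset_ring_hom:
  "path_coset L \<in> ring_hom path_algebra
     (truncated_path_algebra L :: ('r quiver_path \<Rightarrow>\<^sub>0 'k::field) set ring)"
proof -
  interpret I: ideal "path_ideal (L + 1)" "path_algebra :: ('r quiver_path \<Rightarrow>\<^sub>0 'k) ring"
    by (rule ideal_path_ideal)
  show ?thesis
    using I.rcos_ring_hom unfolding path_coset_def truncated_path_algebra_def by (simp add: fun_eq_iff)
qed

lemma path_coset_mult: "path_coset L f \<otimes>\<^bsub>truncated_path_algebra L\<^esub> path_coset L g = path_coset L (f * g)"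
  using ring_hom_mult[OF path_coset_ring_hom, of f g L] by (simp add: path_algebra_simps)

lemma path_coset_add: "path_coset L f \<oplus>\<^bsub>truncated_path_algebra L\<^esub> path_coset L g = path_coset L (f + g)"
  using ring_hom_add[OF path_coset_ring_hom, of f g L] by (simp add: path_algebra_simps)

lemma carrier_truncated: "carrier (truncated_path_algebra L) = range (path_coset L)"
  by (auto simp: truncated_path_algebra_def FactRing_def A_RCOSETS_def' path_algebra_simps path_coset_def)

lemma path_coset_eq: "path_coset L f = path_coset L g \<longleftrightarrow> f - g \<in> long_part (L + 1)"
  for f g :: "'r quiver_path \<Rightarrow>\<^sub>0 'k::field"
proof -
  interpret I: ideal "path_ideal (L + 1)" "path_algebra :: ('r quiver_path \<Rightarrow>\<^sub>0 'k) ring"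
    by (rule ideal_path_ideal)
  have "path_coset L f = path_coset L g \<longleftrightarrow> f \<ominus>\<^bsub>path_algebra\<^esub> g \<in> path_ideal (L + 1)"
    unfolding path_coset_def by (rule I.quotient_eq_iff_same_a_r_cos[symmetric, OF I.ideal_axioms]) (simp_all add: path_algebra_simps)
  then show ?thesis
    by (simp add: a_minus_def a_inv_path_algebra path_algebra_simps path_ideal_eq_long_part)
qed

lemma path_coset_zero: "\<zero>\<^bsub>truncated_path_algebra L\<^esub> = path_coset L (0 :: 'r quiver_path \<Rightarrow>\<^sub>0 'k::field)"
  using ring_hom_zero[OF path_coset_ring_hom ring_path_algebra ring_truncated_path_algebra, of L]
  unfolding path_algebra_simps by (rule sym)

section \<open>Maximal left ideals and the powers of the radical\<close>

lemma left_ideal_image: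
  fixes J :: "('r quiver_path \<Rightarrow>\<^sub>0 'k::field) set"
  assumes zero: "0 \<in> J" and add: "\<And>f g. f \<in> J \<Longrightarrow> g \<in> J \<Longrightarrow> f + g \<in> J"
    and mult: "\<And>f g. g \<in> J \<Longrightarrow> f * g \<in> J"
  shows "left_ideal (path_coset L ` J) (truncated_path_algebra L)"
proof -
  interpret T: ring "truncated_path_algebra L :: ('r quiver_path \<Rightarrow>\<^sub>0 'k) set ring"
    by (rule ring_truncated_path_algebra)
  have neg: "\<ominus>\<^bsub>truncated_path_algebra L\<^esub> path_coset L f = path_coset L (- f)"
    for f :: "'r quiver_path \<Rightarrow>\<^sub>0 'k"
    by (rule T.minus_equality) (simp_all add: path_coset_add path_coset_zero carrier_truncated)
  have "subgroup (path_coset L ` J) (add_monoid (truncated_path_algebra L))"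
  proof (rule T.add.subgroupI)
    fix a assume "a \<in> path_coset L ` J"
    then obtain f where f: "f \<in> J" "a = path_coset L f" by blast
    then have "- f \<in> J"
      using mult[of f "- 1"] by simp
    then show "\<ominus>\<^bsub>truncated_path_algebra L\<^esub> a \<in> path_coset L ` J"
      using f neg by auto
  qed (use zero in \<open>auto simp: carrier_truncated path_coset_add intro: add\<close>)
  then show ?thesis
    unfolding left_ideal_def additive_subgroup_def
    by (auto simp: carrier_truncated path_coset_mult intro: mult)
qed

lemma left_ideal_add:
  assumes "left_ideal I (truncated_path_algebra L)" "path_coset L f \<in> I" "path_coset L g \<in> I"
  shows "path_coset L (f + g) \<in> I"
  using assms additive_subgroup.a_closed unfolding left_ideal_def path_coset_add[symmetric] by metis

lemma left_ideal_mult: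
  assumes "left_ideal I (truncated_path_algebra L)" "path_coset L g \<in> I"
  shows "path_coset L (f * g) \<in> I"
  using assms unfolding left_ideal_def path_coset_mult[symmetric] by (auto simp: carrier_truncated)

lemma left_ideal_zero:
  assumes "left_ideal I (truncated_path_algebra L)"
  shows "path_coset L 0 \<in> I"
  using assms additive_subgroup.zero_closed unfolding left_ideal_def path_coset_zero[symmetric] by metis

lemma left_ideal_subset:
  assumes "left_ideal I (truncated_path_algebra L)"
  shows "I \<subseteq> range (path_coset L)"
  using assms additive_subgroup.a_subset unfolding left_ideal_def carrier_truncated[symmetric] by metis

lemma left_ideal_one:
  assumes "left_ideal I (truncated_path_algebra L)" "path_coset L 1 \<in> I"
  shows "I = carrier (truncated_path_algebra L)"
  using left_ideal_mult[OF assms, of "_"] left_ideal_subset[OF assms(1)] by (auto simp: carrier_truncated)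

lemma left_ideal_long_part: "left_ideal (path_coset L ` long_part m) (truncated_path_algebra L)"
  by (rule left_ideal_image) (use long_part_mult[of _ 0 _ m] in \<open>auto intro: long_part_add\<close>)

text \<open>Modulo this ideal only the constant coefficient survives, so the quotient is the field:
  a left ideal containing it and one further element contains a nonzero scalar, hence 1.\<close>

lemma maximal_left_ideal_arrows:
  "maximal_left_ideal (path_coset L ` (long_part 1 :: ('r quiver_path \<Rightarrow>\<^sub>0 'k::field) set)) (truncated_path_algebra L)"
  unfolding maximal_left_ideal_def
proof (intro conjI allI impI)
  let ?A = "path_coset L ` (long_part 1 :: ('r quiver_path \<Rightarrow>\<^sub>0 'k) set)"
  show "left_ideal ?A (truncated_path_algebra L)"
    by (rule left_ideal_long_part)
  show "?A \<noteq> carrier (truncated_path_algebra L)"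
  proof
    assume "?A = carrier (truncated_path_algebra L)"
    then have "path_coset L 1 \<in> ?A"
      unfolding carrier_truncated by blast
    then obtain f :: "'r quiver_path \<Rightarrow>\<^sub>0 'k" where f: "f \<in> long_part 1" "path_coset L 1 = path_coset L f"
      by (elim imageE)
    then have "1 - f \<in> long_part (L + 1)"
      by (simp only: path_coset_eq)
    then have "1 - f \<in> long_part 1"
      by (rule subsetD[OF long_part_mono, rotated]) simp
    then have "(1 - f) + f \<in> long_part 1"
      using f long_part_add by blast
    then have "(1 :: 'r quiver_path \<Rightarrow>\<^sub>0 'k) \<in> long_part 1"
      by (simp only: diff_add_cancel)
    then show False
      unfolding long_part_1 by (simp add: lookup_one)
  qed
next
  fix I assume I: "left_ideal I (truncated_path_algebra L) \<and> path_coset L ` (long_part 1 :: ('r quiver_path \<Rightarrow>\<^sub>0 'k) set) \<subseteq> I"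
  show "I = path_coset L ` long_part 1 \<or> I = carrier (truncated_path_algebra L)"
  proof (cases "I \<subseteq> path_coset L ` long_part 1")
    case False
    then obtain a where a: "a \<in> I" "a \<notin> path_coset L ` long_part 1"
      unfolding subset_iff by blast
    then obtain f where "a = path_coset L f"
      using subsetD[OF left_ideal_subset[OF conjunct1[OF I]]] by blast
    with a have f: "path_coset L f \<in> I" "f \<notin> long_part 1"
      by blast+
    define c where "c = Poly_Mapping.lookup f 0"
    have c: "c \<noteq> 0"
      using f(2) unfolding c_def long_part_1 .
    have "Poly_Mapping.single 0 c - f \<in> long_part 1"
      unfolding long_part_1 by (simp add: c_def lookup_minus)
    then have "path_coset L ((Poly_Mapping.single 0 c - f) + f) \<in> I"
      using I f(1) by (intro left_ideal_add[OF conjunct1[OF I]]) blast+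
    then have "path_coset L (Poly_Mapping.single 0 (1 / c) * (Poly_Mapping.single 0 c - f + f)) \<in> I"
      by (intro left_ideal_mult conjunct1[OF I])
    then have "path_coset L 1 \<in> I"
      using c by (simp add: mult_single)
    then show ?thesis
      using left_ideal_one[OF conjunct1[OF I]] by blast
  qed (use I in blast)
qed

text \<open>A Nakayama-type argument. Otherwise there is an \<open>m \<ge> 1\<close> such that
  \<open>long_part (m + 1)\<close> maps into \<open>I\<close> but \<open>long_part m\<close> does
  not. Maximality gives \<open>1 = f + g\<close> on cosets with \<open>f\<close> from
  \<open>I\<close> and \<open>g\<close> from \<open>long_part m\<close>. Then
  \<open>g = g * f + g * g\<close> lies in \<open>I\<close>, because the paths in
  \<open>g * g\<close> have length at least \<open>2 * m\<close>; so 1 lies in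
  \<open>I\<close>.\<close>

lemma arrows_le_maximal_left_ideal:
  fixes I :: "('r quiver_path \<Rightarrow>\<^sub>0 'k::field) set set"
  assumes I: "maximal_left_ideal I (truncated_path_algebra L)"
  shows "path_coset L ` long_part 1 \<subseteq> I"
proof (rule ccontr)
  assume not1: "\<not> path_coset L ` long_part 1 \<subseteq> I"
  have li: "left_ideal I (truncated_path_algebra L)"
    using I by (simp add: maximal_left_ideal_def)
  have top: "path_coset L ` long_part (L + 1) \<subseteq> I"
  proof (rule image_subsetI)
    fix f :: "'r quiver_path \<Rightarrow>\<^sub>0 'k" assume "f \<in> long_part (L + 1)"
    then have "path_coset L f = path_coset L 0"
      unfolding path_coset_eq by simp
    then show "path_coset L f \<in> I"
      using left_ideal_zero[OF li] by (simp only:)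
  qed
  \<comment> \<open>The images of the \<open>long_part m\<close> reach zero at \<open>L + 1\<close>,
    so somewhere the inclusion in \<open>I\<close> sets in.\<close>
  have "\<exists>m\<ge>1. \<not> path_coset L ` long_part m \<subseteq> I \<and> path_coset L ` long_part (m + 1) \<subseteq> I"
  proof (rule ccontr)
    assume *: "\<not> ?thesis"
    have "path_coset L ` long_part 1 \<subseteq> I"
      by (rule inc_induct[of 1 "L + 1" "\<lambda>m. path_coset L ` long_part m \<subseteq> I"])
        (use top * in \<open>metis Suc_eq_plus1 le_add2 le_trans\<close>)+
    then show False
      using not1 by contradiction
  qed
  then obtain m where m: "1 \<le> m" "\<not> path_coset L ` long_part m \<subseteq> I" "path_coset L ` long_part (m + 1) \<subseteq> I"
    by blast
  \<comment> \<open>On representatives, this is the sum of \<open>I\<close> and the image of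
    \<open>long_part m\<close>.\<close>
  define J where "J = {f + g | f g. path_coset L f \<in> I \<and> g \<in> long_part m}"
  have J: "left_ideal (path_coset L ` J) (truncated_path_algebra L)"
  proof (rule left_ideal_image)
    show "0 \<in> J"
      unfolding J_def using left_ideal_zero[OF li] by (intro CollectI exI[of _ 0]) auto
    fix a b assume "a \<in> J"
    then obtain f g where fg: "a = f + g" "path_coset L f \<in> I" "g \<in> long_part m"
      by (auto simp: J_def)
    show "b * a \<in> J"
      unfolding J_def
      using fg left_ideal_mult[OF li, of f b] long_part_mult[of b 0 g m]
      by (intro CollectI exI[of _ "b * f"] exI[of _ "b * g"]) (auto simp: distrib_left)
    assume "b \<in> J"
    then obtain f' g' where fg': "b = f' + g'" "path_coset L f' \<in> I" "g' \<in> long_part m"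
      by (auto simp: J_def)
    show "a + b \<in> J"
      unfolding J_def
      using fg fg' left_ideal_add[OF li, of f f'] long_part_add[of g m g']
      by (intro CollectI exI[of _ "f + f'"] exI[of _ "g + g'"]) (auto simp: algebra_simps)
  qed
  have sub: "I \<subseteq> path_coset L ` J"
  proof
    fix a assume "a \<in> I"
    then obtain f where "a = path_coset L f" "path_coset L f \<in> I"
      using left_ideal_subset[OF li] by blast
    then show "a \<in> path_coset L ` J"
      unfolding J_def by (intro image_eqI[of _ _ f] CollectI exI[of _ f] exI[of _ 0]) auto
  qed
  have "path_coset L ` long_part m \<subseteq> path_coset L ` J"
    unfolding J_def using left_ideal_zero[OF li]
    by (intro image_mono subsetI CollectI) (metis add_0)
  then have "path_coset L ` J \<noteq> I"
    using m(2) by blast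
  then have "path_coset L ` J = carrier (truncated_path_algebra L)"
    using I J sub unfolding maximal_left_ideal_def by blast
  then obtain f g where fg: "path_coset L 1 = path_coset L (f + g)" "path_coset L f \<in> I" "g \<in> long_part m"
    unfolding J_def carrier_truncated image_def by blast
  have "path_coset L g = path_coset L (g * 1)"
    by simp
  also have "\<dots> = path_coset L (g * (f + g))"
    unfolding path_coset_mult[symmetric] fg(1) ..
  also have "\<dots> = path_coset L (g * f + g * g)"
    by (simp add: distrib_left)
  also have "\<dots> \<in> I"
  proof (rule left_ideal_add[OF li left_ideal_mult[OF li fg(2)]])
    have "g * g \<in> long_part (m + 1)"
      using m(1) by (intro subsetD[OF long_part_mono long_part_mult[OF fg(3) fg(3)]]) simp
    then show "path_coset L (g * g) \<in> I"
      using m(3) by blast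
  qed
  finally have "path_coset L 1 \<in> I"
    unfolding fg(1) by (rule left_ideal_add[OF li fg(2)])
  then show False
    using left_ideal_one[OF li] I unfolding maximal_left_ideal_def by blast
qed

text \<open>By the two preceding lemmas the algebra is local, with the image of
  \<open>long_part 1\<close> as its unique maximal left ideal.\<close>

lemma rad_eq: "rad L = path_coset L ` long_part 1"
  unfolding rad_def jacobson_radical_def carrier_truncated
  using maximal_left_ideal_arrows arrows_le_maximal_left_ideal by blast

lemma rad_power_0: "rad_power L 0 = range (path_coset L)"
  by (simp add: rad_power_def ideals_set_def carrier_truncated)

lemma rad_power_Suc: "rad_power L (Suc m) = ideal_prod (truncated_path_algebra L) (rad_power L m) (rad L)"
  by (simp add: rad_power_def ideals_set_def)

lemma rad_power_subset:
  "(rad_power L m :: ('r quiver_path \<Rightarrow>\<^sub>0 'k::field) set set) \<subseteq> path_coset L ` long_part m"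
proof (induction m)
  case (Suc m)
  have "a \<in> path_coset L ` long_part (Suc m)"
    if "a \<in> ideal_prod (truncated_path_algebra L) (rad_power L m) (rad L)"
    for a :: "('r quiver_path \<Rightarrow>\<^sub>0 'k) set"
    using that
  proof induction
    case (prod i j)
    then obtain f g where "f \<in> long_part m" "g \<in> long_part 1" "i = path_coset L f" "j = path_coset L g"
      using Suc unfolding rad_eq by blast
    then show ?case
      using long_part_mult[of f m g 1] by (simp add: path_coset_mult)
  next
    case (sum s1 s2)
    then show ?case
      by (auto simp: path_coset_add intro!: long_part_add)
  qed
  then show ?case
    unfolding rad_power_Suc by blast
qed (simp add: rad_power_0)

text \<open>The induction strips the last arrow, because each further power of the radical
  multiplies on the right. With \<open>rad_power_subset\<close> this bounds the powers from both
  sides.\<close>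

lemma path_in_rad_power: "path_coset L (Poly_Mapping.single p (1::'k::field)) \<in> rad_power L (length (arrows p))"
proof (induction "arrows p" arbitrary: p rule: rev_induct)
  case Nil
  then show ?case
    by (metis list.size(3) rad_power_0 rangeI)
next
  case (snoc i xs)
  have eq: "Poly_Mapping.single p (1::'k) = Poly_Mapping.single (Path xs) 1 * Poly_Mapping.single (Path [i]) 1"
    using snoc(2)[symmetric] by (cases p) (simp add: mult_single plus_quiver_path_def)
  have "path_coset L (Poly_Mapping.single (Path [i]) (1::'k)) \<in> rad L"
    unfolding rad_eq by (intro imageI single_long_part) simp
  then show ?case
    using snoc(1)[of "Path xs"] ideal_prod.prod unfolding eq path_coset_mult[symmetric] snoc(2)[symmetric]
    by (simp add: rad_power_Suc)
qed

section \<open>Action of paths, submodules and Loewy length\<close>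

lemma act_path_coset: "x \<in> rep_variety L \<Longrightarrow> act x (path_coset L f) v = path_algebra_act x f v"
  unfolding path_coset_def by (rule act_coset)

lemma act_path: "x \<in> rep_variety L \<Longrightarrow>
    act x (path_coset L (Poly_Mapping.single p 1)) v = path_matrix x p *v v"
  by (simp add: act_path_coset path_algebra_act_single)

lemma path_matrix_Nil [simp]: "path_matrix x (Path []) = mat 1"
  and path_matrix_Cons: "path_matrix x (Path (i # w)) = x $ i ** path_matrix x (Path w)"
  by (simp_all add: path_matrix_def)

lemma path_matrix_long:
  assumes "x \<in> rep_variety L" "L + 1 \<le> length (arrows p)"
  shows "path_matrix x p = 0"
proof -
  have "p = Path (take (L + 1) (arrows p)) + Path (drop (L + 1) (arrows p))"
    by (simp add: plus_quiver_path_def)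
  moreover have "path_matrix x (Path (take (L + 1) (arrows p))) = 0"
    using assms unfolding rep_variety_def by simp
  ultimately show ?thesis
    by (metis path_matrix_add times0_left)
qed

text \<open>The arrows generate the algebra, so stability under them suffices.\<close>

lemma submodule_iff:
  assumes x: "x \<in> rep_variety L"
  shows "submodule L x N \<longleftrightarrow> vec.subspace N \<and> (\<forall>i. \<forall>v\<in>N. x $ i *v v \<in> N)"
proof (intro iffI conjI allI ballI)
  fix i v assume "submodule L x N" "v \<in> N"
  then show "x $ i *v v \<in> N"
    unfolding submodule_def carrier_truncated
    using act_path[OF x, of "Path [i]" v] by (metis matrix_mul_rid path_matrix_Cons path_matrix_Nil rangeI)
next
  assume N: "vec.subspace N \<and> (\<forall>i. \<forall>v\<in>N. x $ i *v v \<in> N)"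
  have *: "path_matrix x (Path w) *v v \<in> N" if "v \<in> N" for w v
    using that N by (induction w) (auto simp: path_matrix_Cons matrix_vector_mul_assoc[symmetric])
  have "path_matrix x p *v v \<in> N" if "v \<in> N" for p v
    using *[OF that, of "arrows p"] by simp
  then have "path_algebra_act x f v \<in> N" if "v \<in> N" for f v
    using N that unfolding path_algebra_act_def by (intro vec.subspace_sum vec.subspace_scale) auto
  then show "submodule L x N"
    using N unfolding submodule_def carrier_truncated by (auto simp: act_path_coset[OF x])
qed (simp add: submodule_def)

text \<open>For a point of the representation variety this is \<open>JM\<close>, since a nonempty
  path maps into the image of the arrow applied last.\<close>

definition radical_part :: "'k::field^'n^'n^'r \<Rightarrow> ('k^'n) set" where
  "radical_part x = vec.span {x $ i *v v | i v. True}"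

text \<open>A vector outside \<open>JM\<close> is thus outside \<open>radical_part x\<close>, the
  form in which the condition of the theorem is verified.\<close>

lemma radical_part_le:
  assumes x: "x \<in> rep_variety L"
  shows "radical_part x \<subseteq> ideal_smult x (rad L) UNIV"
  unfolding radical_part_def ideal_smult_def
proof (rule vec.span_mono, safe)
  fix i and v :: "'a^'b"
  have "x $ i *v v = act x (path_coset L (Poly_Mapping.single (Path [i]) 1)) v"
    using act_path[OF x, of "Path [i]" v] by (simp add: path_matrix_Cons)
  moreover have "path_coset L (Poly_Mapping.single (Path [i]) 1) \<in> rad L"
    unfolding rad_eq by (intro imageI single_long_part) simp
  ultimately show "\<exists>a va. x $ i *v v = act x a va \<and> a \<in> rad L \<and> va \<in> UNIV"
    by blast
qed

lemma rad_power_image_nonzero: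
  assumes "x \<in> rep_variety L" and "length (arrows p) = m" and "path_matrix x p *v v \<noteq> 0"
  shows "(\<lambda>a. act x a v) ` rad_power L m \<noteq> {0}"
proof -
  have "act x (path_coset L (Poly_Mapping.single p 1)) v \<in> (\<lambda>a. act x a v) ` rad_power L m"
    using path_in_rad_power assms(2) by blast
  then show ?thesis
    using act_path[OF assms(1), of p v] assms(3) by auto
qed

text \<open>Paths of length \<open>L + 1\<close> vanish, which bounds the Loewy length above; the
  tails of \<open>p\<close> act nontrivially on \<open>v\<close>, which bounds it below.\<close>

lemma loewy_length_eq:
  assumes x: "x \<in> rep_variety L" and N: "submodule L x N" "v \<in> N"
    and p: "length (arrows p) = L" "path_matrix x p *v v \<noteq> 0"
  shows "loewy_length L x N = L + 1"
  unfolding loewy_length_def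
proof (rule Least_equality)
  have "act x a u = 0" if a: "a \<in> rad_power L (L + 1)" for a u
  proof -
    obtain f where f: "f \<in> long_part (L + 1)" "a = path_coset L f"
      using a rad_power_subset by blast
    then show ?thesis
      using path_matrix_long[OF x]
      by (auto simp: act_path_coset[OF x] path_algebra_act_def long_part_def intro!: sum.neutral)
  qed
  then have "{act x a v | a v. a \<in> rad_power L (L + 1) \<and> v \<in> N} \<subseteq> {0}"
    by blast
  then show "ideal_smult x (rad_power L (L + 1)) N = {0}"
    unfolding ideal_smult_def using vec.span_mono vec.span_zero
    by (metis (no_types, lifting) insert_absorb insert_subset subset_singletonD vec.span_empty vec.span_insert_0)
next
  fix m assume m: "ideal_smult x (rad_power L m) N = {0}"
  show "L + 1 \<le> m"
  proof (rule ccontr)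
    assume "\<not> L + 1 \<le> m"
    \<comment> \<open>The tail \<open>s\<close> acts first, so if it killed \<open>v\<close> then
      \<open>p\<close> would kill it too.\<close>
    define q where "q = Path (take (L - m) (arrows p))"
    define s where "s = Path (drop (L - m) (arrows p))"
    have "p = q + s" "length (arrows s) = m"
      using \<open>\<not> L + 1 \<le> m\<close> p(1) by (auto simp: q_def s_def plus_quiver_path_def)
    then have "act x (path_coset L (Poly_Mapping.single s 1)) v \<in> ideal_smult x (rad_power L m) N"
      unfolding ideal_smult_def using path_in_rad_power[of L s] N(2)
      by (intro vec.span_base) blast
    then have "path_matrix x s *v v = 0"
      using m act_path[OF x] by auto
    then show False
      using p(2) \<open>p = q + s\<close> by (simp add: path_matrix_add matrix_vector_mul_assoc[symmetric])
  qed
qed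

section \<open>Decompositions\<close>

lemma sum_lessThan_add:
  "(\<Sum>i<k + m. f i) = (\<Sum>i<k. f i) + (\<Sum>i<m. f (k + i :: nat) :: 'a::comm_monoid_add)"
  by (induction m) (simp_all add: add.assoc)

text \<open>Induction on the dimension, splitting a decomposable submodule in two. Existence and
  independence of the components are separate clauses because each passes directly to a concatenated
  family.\<close>

lemma exists_indecomposable_decomposition:
  assumes "submodule L x W"
  shows "\<exists>k N. (\<forall>i<k. indecomposable L x (N i) \<and> N i \<subseteq> W) \<and>
    (\<forall>v\<in>W. \<exists>u. (\<forall>i<k. u i \<in> N i) \<and> v = (\<Sum>i<k::nat. u i)) \<and>
    (\<forall>u. (\<forall>i<k. u i \<in> N i) \<and> (\<Sum>i<k. u i) = 0 \<longrightarrow> (\<forall>i<k. u i = 0))"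
  using assms
proof (induction "vec.dim W" arbitrary: W rule: less_induct)
  case less
  have sub: "vec.subspace W"
    using less.prems by (simp add: submodule_def)
  consider "W = {0}" | "indecomposable L x W" | "W \<noteq> {0}" "\<not> indecomposable L x W" by blast
  then show ?case
  proof cases
    case 1
    then show ?thesis
      by (intro exI[of _ 0] exI[of _ "\<lambda>_. {}"]) auto
  next
    case 2
    then show ?thesis
      by (intro exI[of _ 1] exI[of _ "\<lambda>_. W"]) (auto intro!: exI[of _ "\<lambda>_. _"])
  next
    case 3
    then obtain A B where AB: "submodule L x A" "submodule L x B" "A \<noteq> {0}" "B \<noteq> {0}" "A \<inter> B = {0}"
        "W = {a + b | a b. a \<in> A \<and> b \<in> B}"
      using less.prems unfolding indecomposable_def by auto
    have subAB: "vec.subspace A" "vec.subspace B"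
      using AB by (simp_all add: submodule_def)
    have A0: "0 \<in> A" and B0: "0 \<in> B"
      using AB(5) by auto
    have AW: "A \<subseteq> W"
      unfolding AB(6) using B0 by (metis (mono_tags, lifting) add.right_neutral mem_Collect_eq subsetI)
    have BW: "B \<subseteq> W"
      unfolding AB(6) using A0 by (metis (mono_tags, lifting) add.left_neutral mem_Collect_eq subsetI)
    have "A \<noteq> W" "B \<noteq> W"
      using AW BW AB(3-5) by auto
    then have dim: "vec.dim A < vec.dim W" "vec.dim B < vec.dim W"
      using AW BW subAB sub
      by (metis linorder_not_less vec.subspace_dim_equal)+
    obtain k N where kN: "\<forall>i<k. indecomposable L x (N i) \<and> N i \<subseteq> A"
      "\<forall>v\<in>A. \<exists>u. (\<forall>i<k. u i \<in> N i) \<and> v = (\<Sum>i<k::nat. u i)"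
      "\<forall>u. (\<forall>i<k. u i \<in> N i) \<and> (\<Sum>i<k. u i) = 0 \<longrightarrow> (\<forall>i<k. u i = 0)"
      using less.hyps[OF dim(1) AB(1)] by blast
    obtain m M where mM: "\<forall>i<m. indecomposable L x (M i) \<and> M i \<subseteq> B"
      "\<forall>v\<in>B. \<exists>u. (\<forall>i<m. u i \<in> M i) \<and> v = (\<Sum>i<m::nat. u i)"
      "\<forall>u. (\<forall>i<m. u i \<in> M i) \<and> (\<Sum>i<m. u i) = 0 \<longrightarrow> (\<forall>i<m. u i = 0)"
      using less.hyps[OF dim(2) AB(2)] by blast
    define P where "P i = (if i < k then N i else M (i - k))" for i
    show ?thesis
    proof (intro exI[of _ "k + m"] exI[of _ P] conjI allI ballI impI)
      fix i assume "i < k + m"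
      then have "i - k < m" if "\<not> i < k"
        using that by linarith
      then show "indecomposable L x (P i)" "P i \<subseteq> W"
        using kN(1) mM(1) AW BW unfolding P_def by (cases "i < k"; simp; metis subset_trans)+
    next
      fix v assume "v \<in> W"
      then obtain a b where ab: "v = a + b" "a \<in> A" "b \<in> B"
        unfolding AB(6) by blast
      obtain u where u: "\<forall>i<k. u i \<in> N i" "a = (\<Sum>i<k. u i)"
        using kN(2) ab(2) by blast
      obtain w where w: "\<forall>i<m. w i \<in> M i" "b = (\<Sum>i<m. w i)"
        using mM(2) ab(3) by blast
      show "\<exists>u. (\<forall>i<k + m. u i \<in> P i) \<and> v = (\<Sum>i<k + m. u i)"
        by (rule exI[of _ "\<lambda>i. if i < k then u i else w (i - k)"])
          (use u w ab(1) in \<open>auto simp: P_def sum_lessThan_add\<close>)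
    next
      fix u i assume u: "(\<forall>i<k + m. u i \<in> P i) \<and> sum u {..<k + m} = 0" and i: "i < k + m"
      have uN: "\<forall>i<k. u i \<in> N i"
        using u by (metis P_def trans_less_add1)
      have uM: "\<forall>i<m. u (k + i) \<in> M i"
        using u by (metis P_def add_diff_cancel_left' nat_add_left_cancel_less not_add_less1)
      have a: "(\<Sum>i<k. u i) \<in> A"
        using uN kN(1) by (intro vec.subspace_sum[OF subAB(1)]) blast
      have b: "(\<Sum>i<m. u (k + i)) \<in> B"
        using uM mM(1) by (intro vec.subspace_sum[OF subAB(2)]) blast
      have s: "(\<Sum>i<k. u i) + (\<Sum>i<m. u (k + i)) = 0"
        using u by (simp add: sum_lessThan_add)
      then have "(\<Sum>i<k. u i) = - (\<Sum>i<m. u (k + i))"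
        by (rule eq_neg_iff_add_eq_0[THEN iffD2])
      then have "(\<Sum>i<k. u i) \<in> B"
        using b vec.subspace_neg[OF subAB(2)] by metis
      then have "(\<Sum>i<k. u i) = 0"
        using a AB(5) by blast
      moreover from this s have "(\<Sum>i<m. u (k + i)) = 0"
        by simp
      ultimately have "\<forall>i<k. u i = 0" "\<forall>i<m. u (k + i) = 0"
        using kN(3) uN mM(3)[rule_format, of "\<lambda>i. u (k + i)"] uM by blast+
      then show "u i = 0"
        using i by (metis add_diff_inverse_nat nat_add_left_cancel_less)
    qed
  qed
qed

text \<open>Setting the components beyond \<open>k\<close> to zero makes the component function
  unique, as \<open>decomposition\<close> demands.\<close>

lemma exists_decomposition:
  assumes x: "x \<in> rep_variety L"
  shows "\<exists>k N. decomposition L x k N \<and> (\<forall>i<k. indecomposable L x (N i))"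
proof -
  have "submodule L x UNIV"
    by (simp add: submodule_iff[OF x])
  then obtain k N where kN: "\<forall>i<k. indecomposable L x (N i)"
      "\<forall>v. \<exists>u. (\<forall>i<k. u i \<in> N i) \<and> v = (\<Sum>i<k::nat. u i)"
      "\<forall>u. (\<forall>i<k. u i \<in> N i) \<and> (\<Sum>i<k. u i) = 0 \<longrightarrow> (\<forall>i<k. u i = 0)"
    using exists_indecomposable_decomposition[of L x UNIV] by fastforce
  have sub: "submodule L x (N i)" "vec.subspace (N i)" if "i < k" for i
    using kN(1) that by (auto simp: indecomposable_def submodule_def)
  have "\<exists>!u. (\<forall>i<k. u i \<in> N i) \<and> (\<forall>i\<ge>k. u i = 0) \<and> v = (\<Sum>i<k. u i)" for v
  proof (rule ex_ex1I)
    obtain u where u: "\<forall>i<k. u i \<in> N i" "v = (\<Sum>i<k. u i)"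
      using kN(2) by blast
    then show "\<exists>u. (\<forall>i<k. u i \<in> N i) \<and> (\<forall>i\<ge>k. u i = 0) \<and> v = (\<Sum>i<k. u i)"
      by (intro exI[of _ "\<lambda>i. if i < k then u i else 0"]) auto
  next
    fix u w
    assume u: "(\<forall>i<k. u i \<in> N i) \<and> (\<forall>i\<ge>k. u i = 0) \<and> v = (\<Sum>i<k. u i)"
      and w: "(\<forall>i<k. w i \<in> N i) \<and> (\<forall>i\<ge>k. w i = 0) \<and> v = (\<Sum>i<k. w i)"
    have "\<forall>i<k. u i - w i \<in> N i"
      using u w sub vec.subspace_diff by blast
    moreover have "(\<Sum>i<k. u i - w i) = 0"
      using u w by (simp add: sum_subtractf)
    ultimately have "\<forall>i<k. u i - w i = 0"
      using kN(3)[rule_format, of "\<lambda>i. u i - w i"] by blast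
    then show "u = w"
      using u w by (metis eq_iff_diff_eq_0 ext linorder_not_less)
  qed
  then show ?thesis
    using kN(1) sub unfolding decomposition_def by blast
qed

text \<open>
  A summand inside \<open>JM\<close> satisfies \<open>N = JN\<close> by projecting, hence vanishes because \<open>J\<close> is nilpotent.
\<close>

lemma summand_not_le_radical_part:
  assumes x: "x \<in> rep_variety L" and dec: "decomposition L x k N" and i: "i < k" "N i \<noteq> {0}"
  shows "\<not> N i \<subseteq> radical_part x"
proof
  assume le: "N i \<subseteq> radical_part x"
  have sub: "vec.subspace (N j)" "\<And>a v. v \<in> N j \<Longrightarrow> x $ a *v v \<in> N j" if "j < k" for j
    using dec that submodule_iff[OF x] unfolding decomposition_def by blast+
  have ex: "\<exists>u. (\<forall>i<k. u i \<in> N i) \<and> (\<forall>i\<ge>k. u i = 0) \<and> v = (\<Sum>i<k. u i)" for v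
    using dec unfolding decomposition_def by blast
  have unique: "u = w" if "\<forall>i<k. u i \<in> N i" "\<forall>i\<ge>k. u i = 0" "\<forall>i<k. w i \<in> N i" "\<forall>i\<ge>k. w i = 0"
      "(\<Sum>i<k. u i) = (\<Sum>i<k. w i)" for u w
    using dec that unfolding decomposition_def by blast
  obtain U where U: "\<And>v. \<forall>j<k. U v j \<in> N j" "\<And>v. \<forall>j\<ge>k. U v j = 0" "\<And>v. v = (\<Sum>j<k. U v j)"
    using ex by metis
  \<comment> \<open>Uniqueness of the components makes the projection to \<open>N i\<close> linear
    and compatible with the arrows.\<close>
  have add: "U (v + w) i = U v i + U w i" for v w
  proof -
    have "U (v + w) = (\<lambda>i. U v i + U w i)"
      using U(1,2) sub(1)
      by (intro unique) (auto simp: sum.distrib U(3)[symmetric] intro: vec.subspace_add)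
    then show ?thesis by simp
  qed
  have scale: "U (c *s v) i = c *s U v i" for c v
  proof -
    have "U (c *s v) = (\<lambda>i. c *s U v i)"
      using U(1,2) sub(1)
      by (intro unique) (auto simp: vec.scale_sum_right[symmetric] U(3)[symmetric] intro: vec.subspace_scale)
    then show ?thesis by simp
  qed
  have mult: "U (x $ a *v v) i = x $ a *v U v i" for a v
  proof -
    have "x $ a *v v = (\<Sum>i<k. x $ a *v U v i)"
      by (simp add: vec.linear_sum[OF matrix_vector_mul_linear_gen, symmetric] U(3)[symmetric])
    then have "U (x $ a *v v) = (\<lambda>i. x $ a *v U v i)"
      using U(1,2) sub(2)
      by (intro unique) (auto simp: U(3)[symmetric])
    then show ?thesis by simp
  qed
  have self: "U v i = v" if "v \<in> N i" for v
  proof -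
    have "U v = (\<lambda>j. if j = i then v else 0)"
      using U(1,2) i(1) that sub(1)
      by (intro unique) (auto simp: U(3)[symmetric] intro: vec.subspace_0)
    then show ?thesis by simp
  qed
  let ?J = "vec.span {x $ a *v u | a u. u \<in> N i}"
  \<comment> \<open>Being a module map, the projection sends \<open>JM\<close> into the span of the
    arrow images of \<open>N i\<close>.\<close>
  have proj: "U v i \<in> ?J" if "v \<in> radical_part x" for v
    using that unfolding radical_part_def
  proof (induction rule: vec.span_induct)
    show "vec.subspace {v. U v i \<in> ?J}"
      by (rule vec.subspaceI)
        (use scale[of 0 0] in \<open>auto simp: add scale vec.span_zero vec.span_add vec.span_scale\<close>)
  next
    fix w assume "w \<in> {x $ i *v v | i v. True}"
    then obtain a v where "w = x $ a *v v" by blast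
    then show "U w i \<in> ?J"
      using U(1) i(1) by (auto simp: mult intro!: vec.span_base)
  qed
  have J: "v \<in> ?J" if "v \<in> N i" for v
    using proj[OF subsetD[OF le that]] unfolding self[OF that] .
  \<comment> \<open>A longest path acting nontrivially on \<open>N i\<close> exists: length 0
    qualifies because \<open>N i\<close> is nonzero, and lengths beyond \<open>L\<close> do
    not.\<close>
  define P where "P m \<longleftrightarrow> (\<exists>p u. length (arrows p) = m \<and> u \<in> N i \<and> path_matrix x p *v u \<noteq> 0)" for m
  obtain u where "u \<in> N i" "u \<noteq> 0"
    using i sub(1) vec.subspace_0 by blast
  then have "P 0"
    unfolding P_def by (intro exI[of _ "Path []"] exI[of _ u]) simp
  moreover have bound: "m \<le> L" if "P m" for m
  proof (rule ccontr)
    assume "\<not> m \<le> L"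
    then show False
      using that path_matrix_long[OF x] unfolding P_def by force
  qed
  ultimately obtain m where m: "P m" "\<And>m'. P m' \<Longrightarrow> m' \<le> m"
    using Nat.ex_has_greatest_nat[of P 0 L] by blast
  then obtain p u where p: "length (arrows p) = m" "u \<in> N i" "path_matrix x p *v u \<noteq> 0"
    unfolding P_def by blast
  \<comment> \<open>By maximality of its length, \<open>p\<close> kills \<open>?J\<close>, which
    contains \<open>N i\<close>.\<close>
  have "path_matrix x p *v v = 0" if "v \<in> ?J" for v
    using that
  proof (induction rule: vec.span_induct)
    show "vec.subspace {v. path_matrix x p *v v = 0}"
      by (rule vec.subspaceI) (auto simp: matrix_vector_right_distrib vector_scalar_commute)
  next
    fix w assume "w \<in> {x $ a *v u | a u. u \<in> N i}"
    then obtain a v where w: "w = x $ a *v v" "v \<in> N i" by blast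
    show "path_matrix x p *v w = 0"
    proof (rule ccontr)
      assume "path_matrix x p *v w \<noteq> 0"
      then have "path_matrix x (p + Path [a]) *v v \<noteq> 0"
        by (simp add: w path_matrix_add path_matrix_Cons matrix_vector_mul_assoc)
      then have "P (m + 1)"
        unfolding P_def using w(2) p(1) by (intro exI[of _ "p + Path [a]"] exI[of _ v]) (simp add: length_arrows_plus)
      then show False
        using m(2) by fastforce
    qed
  qed
  then show False
    using J p by blast
qed

text \<open>No nonzero summand is contained in \<open>radical_part x\<close>, so each has a vector
  on which some path of length \<open>L\<close> is nonzero.\<close>

lemma exists_decomposition_loewy_length:
  assumes x: "x \<in> rep_variety L"
    and full: "\<And>v. v \<notin> radical_part x \<Longrightarrow> \<exists>p. length (arrows p) = L \<and> path_matrix x p *v v \<noteq> 0"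
  shows "\<exists>k N. decomposition L x k N \<and>
            (\<forall>i<k. indecomposable L x (N i) \<and> loewy_length L x (N i) = L + 1)"
proof -
  obtain k N where kN: "decomposition L x k N" "\<forall>i<k. indecomposable L x (N i)"
    using exists_decomposition[OF x] by blast
  have "loewy_length L x (N i) = L + 1" if i: "i < k" for i
  proof -
    have N: "submodule L x (N i)" "N i \<noteq> {0}"
      using kN(2) i unfolding indecomposable_def by blast+
    obtain v where v: "v \<in> N i" "v \<notin> radical_part x"
      using summand_not_le_radical_part[OF x kN(1) i N(2)] by blast
    then show ?thesis
      using full loewy_length_eq[OF x N(1)] by blast
  qed
  then show ?thesis
    using kN by blast
qed

section \<open>An open condition\<close>

lemma polynomial_functions_sum:
  "(\<And>i. i \<in> I \<Longrightarrow> f i \<in> polynomial_functions) \<Longrightarrow> (\<lambda>x. \<Sum>i\<in>I. f i x) \<in> polynomial_functions"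
  by (induction I rule: infinite_finite_induct) (auto intro: polynomial_functions.const polynomial_functions.add)

lemma polynomial_functions_prod:
  "(\<And>i. i \<in> I \<Longrightarrow> f i \<in> polynomial_functions) \<Longrightarrow> (\<lambda>x. \<Prod>i\<in>I. f i x) \<in> polynomial_functions"
  by (induction I rule: infinite_finite_induct) (auto intro: polynomial_functions.const polynomial_functions.mult)

lemma polynomial_functions_det:
  assumes "\<And>a b. (\<lambda>x. M x $ a $ b) \<in> polynomial_functions"
  shows "(\<lambda>x. det (M x)) \<in> polynomial_functions"
  unfolding det_def
  by (intro polynomial_functions_sum polynomial_functions.mult polynomial_functions.const
      polynomial_functions_prod assms)

lemma polynomial_functions_mult_matrix:
  assumes "\<And>a b. (\<lambda>x. M x $ a $ b) \<in> polynomial_functions" "\<And>a b. (\<lambda>x. N x $ a $ b) \<in> polynomial_functions"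
  shows "(\<lambda>x. (M x ** N x) $ a $ b) \<in> polynomial_functions"
  unfolding matrix_matrix_mult_def
  by (simp, intro polynomial_functions_sum polynomial_functions.mult assms)

lemma polynomial_functions_path_matrix: "(\<lambda>x. path_matrix x (Path w) $ a $ b) \<in> polynomial_functions"
proof (induction w arbitrary: a b)
  case (Cons i w)
  then show ?case
    unfolding path_matrix_Cons
    by (intro polynomial_functions_mult_matrix polynomial_functions.coord)
qed (simp add: polynomial_functions.const)

text \<open>For fixed \<open>P\<close> and \<open>Q\<close> the determinant is a polynomial function
  of \<open>x\<close>. The first sum takes values in \<open>JM\<close>, the second vanishes on
  vectors killed by all paths of length \<open>L\<close>.\<close>

definition test_matrix ::
    "nat \<Rightarrow> ('r::finite \<Rightarrow> 'k::field^'n^'n) \<Rightarrow> ('r list \<Rightarrow> 'k^'n^'n) \<Rightarrow> 'k^'n^'n^'r \<Rightarrow> 'k^'n^'n" where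
  "test_matrix L P Q x =
     (\<Sum>i\<in>UNIV. x $ i ** P i) + (\<Sum>w | length w = L. Q w ** path_matrix x (Path w))"

lemma sum_matrix_vector_mult: "(\<Sum>i\<in>I. A i) *v u = (\<Sum>i\<in>I. A i *v u)"
  by (induction I rule: infinite_finite_induct) (simp_all add: matrix_vector_mult_add_rdistrib)

lemma finite_words: "finite {w :: 'r::finite list. length w = L}"
  using finite_lists_length_eq[of "UNIV :: 'r set" L] by simp

lemma polynomial_functions_test_matrix: "(\<lambda>x. det (test_matrix L P Q x)) \<in> polynomial_functions"
proof (rule polynomial_functions_det)
  fix a b
  have "(\<lambda>x. (\<Sum>i\<in>UNIV. (x $ i ** P i) $ a $ b) + (\<Sum>w | length w = L. (Q w ** path_matrix x (Path w)) $ a $ b))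
      \<in> polynomial_functions"
    by (intro polynomial_functions.add polynomial_functions_sum polynomial_functions_mult_matrix
        polynomial_functions.coord polynomial_functions.const polynomial_functions_path_matrix)
  then show "(\<lambda>x. test_matrix L P Q x $ a $ b) \<in> polynomial_functions"
    by (simp add: test_matrix_def)
qed

text \<open>
  An invertible test matrix maps the annihilator of \<open>J\<^sup>L\<close> injectively into \<open>JM\<close>; the opposite
  inclusion always holds.
\<close>

lemma test_matrix_radical_part:
  fixes x :: "'k::field^'n^'n^'r"
  assumes x: "x \<in> rep_variety L" and det: "det (test_matrix L P Q x) \<noteq> 0"
    and v: "v \<notin> radical_part x"
  shows "\<exists>p. length (arrows p) = L \<and> path_matrix x p *v v \<noteq> 0"
proof (rule ccontr)
  assume "\<not> ?thesis"
  then have vN: "\<forall>p. length (arrows p) = L \<longrightarrow> path_matrix x p *v v = 0"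
    by blast
  define N where "N = {v. \<forall>p. length (arrows p) = L \<longrightarrow> path_matrix x p *v v = 0}"
  have sub: "vec.subspace N"
    unfolding N_def
    by (rule vec.subspaceI) (auto simp: matrix_vector_right_distrib vector_scalar_commute)
  have le: "radical_part x \<subseteq> N"
    unfolding radical_part_def
  proof (rule vec.span_minimal[OF _ sub], safe)
    fix i v
    show "x $ i *v v \<in> N"
      unfolding N_def
    proof (intro CollectI allI impI)
      fix p :: "'r quiver_path" assume "length (arrows p) = L"
      \<comment> \<open>Prolonged by one arrow, a path of length \<open>L\<close> reaches the
        truncation length.\<close>
      then have "path_matrix x (p + Path [i]) = 0"
        by (intro path_matrix_long[OF x]) (simp add: length_arrows_plus)
      then show "path_matrix x p *v (x $ i *v v) = 0"
        by (simp add: path_matrix_add path_matrix_Cons matrix_vector_mul_assoc)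
    qed
  qed
  let ?T = "test_matrix L P Q x"
  have map: "?T *v u \<in> radical_part x" if "u \<in> N" for u
  proof -
    have "(\<Sum>w | length w = L. Q w ** path_matrix x (Path w)) *v u = 0"
      using that unfolding N_def
      by (simp add: sum_matrix_vector_mult matrix_vector_mul_assoc[symmetric])
    then have "?T *v u = (\<Sum>i\<in>UNIV. x $ i *v (P i *v u))"
      by (simp add: test_matrix_def matrix_vector_mult_add_rdistrib sum_matrix_vector_mult
          matrix_vector_mul_assoc[symmetric])
    then show ?thesis
      unfolding radical_part_def by (simp only:) (intro vec.span_sum vec.span_base; blast)
  qed
  \<comment> \<open>Injectivity on \<open>N\<close>, with values in \<open>JM\<close>, bounds the
    dimension of \<open>N\<close> by that of \<open>JM\<close>; together with \<open>le\<close> this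
    forces equality.\<close>
  have "inj ((*v) ?T)"
    using det by (simp add: inj_matrix_vector_mult invertible_det_nz)
  then have "vec.dim ((*v) ?T ` N) = vec.dim N"
    by (intro vec.dim_image_eq matrix_vector_mul_linear_gen) (auto intro: inj_on_subset)
  then have "vec.dim N \<le> vec.dim (radical_part x)"
    using vec.dim_subset[of "(*v) ?T ` N" "radical_part x"] map by auto
  then have "radical_part x = N"
    using le sub unfolding radical_part_def by (intro vec.subspace_dim_equal) auto
  then show False
    using v vN by (simp add: N_def)
qed

section \<open>Irreducible sets\<close>

lemma irreducible_in_finite_Union:
  assumes C: "irreducible_in T C" and fin: "finite I"
    and cl: "\<And>i. i \<in> I \<Longrightarrow> closedin T (F i)" and cover: "C \<subseteq> (\<Union>i\<in>I. F i)"
  shows "\<exists>i\<in>I. C \<subseteq> F i"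
  using fin cl cover
proof (induction I)
  case empty
  then show ?case
    using C by (auto simp: irreducible_in_def)
next
  case (insert i I)
  have "closedin T (F i)" "closedin T (\<Union>i\<in>I. F i)"
    using insert by (auto intro!: closedin_Union)
  then have "C \<subseteq> F i \<or> C \<subseteq> (\<Union>i\<in>I. F i)"
    using C insert.prems(2) unfolding irreducible_in_def by auto
  then show ?case
    using insert by blast
qed

lemma irreducible_in_closure_of:
  assumes D: "irreducible_in T D"
  shows "irreducible_in T (T closure_of D)"
  unfolding irreducible_in_def
proof (intro conjI allI impI)
  have sub: "D \<subseteq> T closure_of D"
    using D by (intro closure_of_subset) (auto simp: irreducible_in_def)
  then show "T closure_of D \<noteq> {}"
    using D by (auto simp: irreducible_in_def)
  fix A B assume AB: "closedin T A \<and> closedin T B \<and> T closure_of D \<subseteq> A \<union> B"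
  then have "D \<subseteq> A \<or> D \<subseteq> B"
    using D sub unfolding irreducible_in_def by (metis order_trans)
  then show "T closure_of D \<subseteq> A \<or> T closure_of D \<subseteq> B"
    using AB closure_of_minimal by metis
qed (simp add: closure_of_subset_topspace)

text \<open>\<open>C\<close> lies in the closure of one member of the family. That closure is
  irreducible, so maximality makes it equal to \<open>C\<close>, and the member itself lies in
  \<open>C\<close>.\<close>

lemma irreducible_component_family:
  assumes C: "irreducible_component T C" and fin: "finite I"
    and D: "\<And>i. i \<in> I \<Longrightarrow> irreducible_in T (D i)" and cover: "C \<subseteq> (\<Union>i\<in>I. D i)"
  shows "\<exists>i\<in>I. D i \<subseteq> C"
proof -
  have sub: "D i \<subseteq> T closure_of D i" if "i \<in> I" for i
    using D[OF that] by (intro closure_of_subset) (auto simp: irreducible_in_def)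
  then have "C \<subseteq> (\<Union>i\<in>I. T closure_of D i)"
    using cover by blast
  then obtain i where "i \<in> I" "C \<subseteq> T closure_of D i"
    using irreducible_in_finite_Union[OF _ fin] C unfolding irreducible_component_def
    by (metis closedin_closure_of)
  moreover from this have "T closure_of D i = C"
    using C D irreducible_in_closure_of unfolding irreducible_component_def by metis
  ultimately show ?thesis
    using sub by blast
qed

text \<open>The closure of \<open>U \<inter> C\<close> and the complement of \<open>U\<close> cover
  \<open>C\<close>, and the second does not contain it.\<close>

lemma dense_open_in_irreducible:
  assumes C: "irreducible_in T C" and U: "openin T U" "U \<inter> C \<noteq> {}"
  shows "dense_open_in (subtopology T C) (U \<inter> C)"
  unfolding dense_open_in_def
proof
  show "openin (subtopology T C) (U \<inter> C)"
    using U by (auto simp: openin_subtopology)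
  have CT: "C \<subseteq> topspace T"
    using C by (simp add: irreducible_in_def)
  have "closedin T (T closure_of (U \<inter> C))" "closedin T (topspace T - U)"
    using U by auto
  moreover have "C \<subseteq> T closure_of (U \<inter> C) \<union> (topspace T - U)"
    using CT closure_of_subset[of "U \<inter> C" T] by blast
  ultimately have "C \<subseteq> T closure_of (U \<inter> C) \<or> C \<subseteq> topspace T - U"
    using C unfolding irreducible_in_def by blast
  then have "C \<subseteq> T closure_of (U \<inter> C)"
    using U(2) by blast
  moreover have "C \<inter> (U \<inter> C) = U \<inter> C"
    by blast
  ultimately show "subtopology T C closure_of (U \<inter> C) = topspace (subtopology T C)"
    using CT by (auto simp: closure_of_subtopology)
qed

text \<open>One witness \<open>z\<close> suffices, because nonvanishing of the determinant is open
  and \<open>C\<close> is irreducible. The condition \<open>Pr\<close> stays arbitrary so that both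
  halves of the theorem can use it.\<close>

lemma generically_test_matrix:
  assumes C: "irreducible_component (subtopology zariski (rep_variety L)) C"
    and z: "z \<in> C" "det (test_matrix L P Q z) \<noteq> 0"
    and Pr: "\<And>x. x \<in> rep_variety L \<Longrightarrow> det (test_matrix L P Q x) \<noteq> 0 \<Longrightarrow> Pr x"
  shows "generically C Pr"
proof -
  let ?R = "subtopology zariski (rep_variety L)"
  let ?U = "{x. det (test_matrix L P Q x) \<noteq> 0}"
  have irr: "irreducible_in ?R C" "C \<subseteq> rep_variety L"
    using C by (auto simp: irreducible_component_def irreducible_in_def)
  have "openin zariski ?U"
    unfolding openin_zariski zero_locus_def
    by (rule exI[of _ "{\<lambda>x. det (test_matrix L P Q x)}"]) (auto simp: polynomial_functions_test_matrix)
  then have "openin ?R (?U \<inter> rep_variety L)"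
    by (auto simp: openin_subtopology)
  then have "dense_open_in (subtopology ?R C) ((?U \<inter> rep_variety L) \<inter> C)"
    by (rule dense_open_in_irreducible[OF irr(1)]) (use z irr(2) in auto)
  moreover have "subtopology ?R C = subtopology zariski C"
    using irr(2) by (simp add: subtopology_subtopology Int_absorb1)
  ultimately show ?thesis
    unfolding generically_def using Pr by auto
qed

section \<open>Families of conjugates of strictly graded matrices\<close>

text \<open>Encodes a flag of coordinate subspaces: its \<open>l\<close>-th term is spanned by the
  basis vectors of level at least \<open>l\<close>, and every matrix raises the level.\<close>

definition graded :: "('n \<Rightarrow> nat) \<Rightarrow> ('k::field^'n^'n^'r) set" where
  "graded lev = {y. \<forall>i a b. y $ i $ a $ b \<noteq> 0 \<longrightarrow> lev b < lev a}"

definition conjugate :: "'k::field^'n^'n \<Rightarrow> 'k^'n^'n \<Rightarrow> 'k^'n^'n^'r \<Rightarrow> 'k^'n^'n^'r" where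
  "conjugate h g y = (\<chi> i. h ** y $ i ** g)"

text \<open>These points respect some flag, not necessarily a coordinate one, whose steps have the
  sizes of the levels of \<open>lev\<close> as dimensions.\<close>

definition graded_orbit :: "('n \<Rightarrow> nat) \<Rightarrow> ('k::field^'n^'n^'r) set" where
  "graded_orbit lev = {conjugate h g y | h g y. g ** h = mat 1 \<and> y \<in> graded lev}"

lemma path_matrix_graded:
  assumes y: "y \<in> graded lev" and nz: "path_matrix y (Path w) $ a $ b \<noteq> 0"
  shows "lev b + length w \<le> lev a"
  using nz
proof (induction w arbitrary: a)
  case Nil
  then show ?case
    by (auto simp: mat_def split: if_splits)
next
  case (Cons i w)
  then obtain c where "y $ i $ a $ c * path_matrix y (Path w) $ c $ b \<noteq> 0"
    unfolding path_matrix_Cons matrix_matrix_mult_def by (auto intro: sum.not_neutral_contains_not_neutral)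
  then have "y $ i $ a $ c \<noteq> 0" "path_matrix y (Path w) $ c $ b \<noteq> 0"
    by auto
  then have "lev c < lev a" "lev b + length w \<le> lev c"
    using y Cons.IH by (auto simp: graded_def)
  then show ?case
    by simp
qed

lemma path_matrix_conjugate:
  assumes "h ** g = mat 1" "g ** h = mat 1"
  shows "path_matrix (conjugate h g y) (Path w) = h ** path_matrix y (Path w) ** g"
proof (induction w)
  case Nil
  then show ?case
    using assms by simp
next
  case (Cons i w)
  have "conjugate h g y $ i ** (h ** path_matrix y (Path w) ** g) =
      h ** y $ i ** (g ** h) ** path_matrix y (Path w) ** g"
    by (simp add: conjugate_def matrix_mul_assoc)
  then show ?case
    using Cons assms by (simp add: path_matrix_Cons matrix_mul_assoc)
qed

text \<open>Each arrow raises the level by at least one, so \<open>L + 1\<close> of them would lead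
  beyond \<open>L\<close>.\<close>

lemma graded_orbit_subset_rep_variety:
  assumes "\<And>a. lev a \<le> L"
  shows "graded_orbit lev \<subseteq> (rep_variety L :: ('k::field^'n^'n^'r) set)"
proof
  fix x :: "'k^'n^'n^'r" assume "x \<in> graded_orbit lev"
  then obtain h g y where x: "x = conjugate h g y" "g ** h = mat 1" "y \<in> graded lev"
    unfolding graded_orbit_def by blast
  show "x \<in> rep_variety L"
    unfolding rep_variety_def
  proof (intro CollectI allI impI)
    fix p :: "'r quiver_path" assume p: "length (arrows p) = L + 1"
    have "path_matrix y (Path (arrows p)) $ a $ b = 0" for a b
    proof (rule ccontr)
      assume "path_matrix y (Path (arrows p)) $ a $ b \<noteq> 0"
      from path_matrix_graded[OF x(3) this] assms[of a] p show False
        by simp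
    qed
    then have "path_matrix y (Path (arrows p)) = 0"
      by (simp add: vec_eq_iff)
    then show "path_matrix x p = 0"
      using path_matrix_conjugate[of h g y "arrows p"] x(1,2) matrix_left_right_inverse[of g h] by simp
  qed
qed

section \<open>Irreducibility of the orbits through one-parameter curves\<close>

definition polynomial_in :: "('k::field \<Rightarrow> 'k) \<Rightarrow> bool" where
  "polynomial_in f \<longleftrightarrow> (\<exists>P. \<forall>t. f t = poly P t)"

lemma polynomial_in_const: "polynomial_in (\<lambda>t. c)"
  unfolding polynomial_in_def by (rule exI[of _ "[:c:]"]) simp

lemma polynomial_in_line: "polynomial_in (\<lambda>t. c + t * d)"
  unfolding polynomial_in_def by (rule exI[of _ "[:c, d:]"]) simp

lemma polynomial_in_add: "polynomial_in f \<Longrightarrow> polynomial_in g \<Longrightarrow> polynomial_in (\<lambda>t. f t + g t)"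
  unfolding polynomial_in_def by (metis poly_add)

lemma polynomial_in_mult: "polynomial_in f \<Longrightarrow> polynomial_in g \<Longrightarrow> polynomial_in (\<lambda>t. f t * g t)"
  unfolding polynomial_in_def by (metis poly_mult)

lemma polynomial_in_power: "polynomial_in f \<Longrightarrow> polynomial_in (\<lambda>t. f t ^ m)"
  by (induction m) (simp_all add: polynomial_in_const polynomial_in_mult)

lemma polynomial_in_sum: "(\<And>i. i \<in> I \<Longrightarrow> polynomial_in (f i)) \<Longrightarrow> polynomial_in (\<lambda>t. \<Sum>i\<in>I. f i t)"
  by (induction I rule: infinite_finite_induct) (simp_all add: polynomial_in_const polynomial_in_add)

lemma polynomial_in_prod: "(\<And>i. i \<in> I \<Longrightarrow> polynomial_in (f i)) \<Longrightarrow> polynomial_in (\<lambda>t. \<Prod>i\<in>I. f i t)"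
  by (induction I rule: infinite_finite_induct) (simp_all add: polynomial_in_const polynomial_in_mult)

lemma polynomial_in_det:
  assumes "\<And>a b. polynomial_in (\<lambda>t. M t $ a $ b)"
  shows "polynomial_in (\<lambda>t. det (M t))"
  unfolding det_def
  by (intro polynomial_in_sum polynomial_in_mult polynomial_in_prod polynomial_in_const assms)

lemma matrix_inv_mult:
  fixes A :: "'k::field^'n^'n"
  assumes "det A \<noteq> 0"
  shows "A ** matrix_inv A = mat 1"
proof -
  have "\<exists>B. A ** B = mat 1 \<and> B ** A = mat 1"
    using assms by (simp add: invertible_det_nz[symmetric] invertible_def)
  then show ?thesis
    unfolding matrix_inv_def by (rule someI2_ex) simp
qed

lemma right_inverse_matrix:
  fixes A :: "'k::field^'n^'n"
  assumes "A ** B = mat 1"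
  shows "det A \<noteq> 0" "matrix_inv A = B"
proof -
  show "det A \<noteq> 0"
    using assms invertible_right_inverse invertible_det_nz by blast
  then have "matrix_inv A ** A = mat 1"
    using matrix_inv_mult matrix_left_right_inverse by blast
  then have "matrix_inv A ** (A ** B) = B"
    by (simp add: matrix_mul_assoc)
  then show "matrix_inv A = B"
    by (simp add: assms)
qed

text \<open>Cramer's rule for column \<open>c\<close> of the inverse: once the determinant is
  cleared, the entries of the inverse are polynomial.\<close>

lemma matrix_inv_cramer:
  fixes A :: "'k::field^'n^'n"
  assumes "det A \<noteq> 0"
  shows "det A * matrix_inv A $ a $ c = det (\<chi> i j. if j = a then (if i = c then 1 else 0) else A $ i $ j)"
proof -
  have "A ** matrix_inv A = mat 1"
    using assms by (rule matrix_inv_mult)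
  then have "A *v column c (matrix_inv A) = (\<chi> i. if i = c then 1 else 0)"
    by (simp add: vec_eq_iff matrix_matrix_mult_def matrix_vector_mult_def column_def mat_def)
  then have "column c (matrix_inv A) =
      (\<chi> k. det (\<chi> i j. if j = k then (\<chi> i. if i = c then 1 else 0) $ i else A $ i $ j) / det A)"
    by (simp only: cramer[OF assms])
  then have "column c (matrix_inv A) $ a =
      (\<chi> k. det (\<chi> i j. if j = k then (\<chi> i. if i = c then 1 else 0) $ i else A $ i $ j) / det A) $ a"
    by (rule arg_cong)
  then have "matrix_inv A $ a $ c = det (\<chi> i j. if j = a then (if i = c then 1 else 0) else A $ i $ j) / det A"
    by (simp add: column_def cong: if_cong)
  then show ?thesis
    using assms by simp
qed

text \<open>The only denominators along the curve come from the inverse of \<open>G t\<close>, and a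
  power of the determinant clears them.\<close>

lemma polynomial_on_conjugates:
  fixes G :: "'k::field \<Rightarrow> 'k^'n^'n" and Y :: "'k \<Rightarrow> 'k^'n^'n^'r"
  assumes G: "\<And>a b. polynomial_in (\<lambda>t. G t $ a $ b)"
    and Y: "\<And>i a b. polynomial_in (\<lambda>t. Y t $ i $ a $ b)"
    and p: "p \<in> polynomial_functions"
  shows "\<exists>f m. polynomial_in f \<and>
    (\<forall>t. det (G t) \<noteq> 0 \<longrightarrow> f t = det (G t) ^ m * p (conjugate (matrix_inv (G t)) (G t) (Y t)))"
  using p
proof induction
  case (const c)
  show ?case
    by (rule exI[of _ "\<lambda>t. c"], rule exI[of _ 0]) (simp add: polynomial_in_const)
next
  case (coord i a b)
  define f where "f t = (\<Sum>e\<in>UNIV. (\<Sum>c\<in>UNIV.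
      det (\<chi> i j. if j = a then (if i = c then 1 else 0) else G t $ i $ j) * Y t $ i $ c $ e) * G t $ e $ b)" for t
  have "polynomial_in (\<lambda>t. (\<chi> i j. if j = a then (if i = c then 1 else 0) else G t $ i $ j) $ k $ l)" for c k l
    using G by (cases "l = a") (simp_all add: polynomial_in_const)
  then have "polynomial_in f"
    unfolding f_def by (intro polynomial_in_sum polynomial_in_mult polynomial_in_det G Y)
  moreover have "f t = det (G t) ^ 1 * conjugate (matrix_inv (G t)) (G t) (Y t) $ i $ a $ b" if "det (G t) \<noteq> 0" for t
    by (simp add: f_def conjugate_def matrix_matrix_mult_def matrix_inv_cramer[OF that, symmetric]
        sum_distrib_left sum_distrib_right mult.assoc)
  ultimately show ?case by blast
next
  case (add p q)
  then obtain f m f' m' where fm: "polynomial_in f" "polynomial_in f'"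
    "\<And>t. det (G t) \<noteq> 0 \<Longrightarrow> f t = det (G t) ^ m * p (conjugate (matrix_inv (G t)) (G t) (Y t))"
    "\<And>t. det (G t) \<noteq> 0 \<Longrightarrow> f' t = det (G t) ^ m' * q (conjugate (matrix_inv (G t)) (G t) (Y t))"
    by blast
  \<comment> \<open>The two powers of the determinant are brought to the common exponent
    \<open>m + m'\<close>.\<close>
  have "polynomial_in (\<lambda>t. det (G t) ^ m' * f t + det (G t) ^ m * f' t)"
    by (intro polynomial_in_add polynomial_in_mult polynomial_in_power polynomial_in_det fm G)
  then show ?case
    by (rule_tac exI, rule_tac exI[of _ "m + m'"], rule_tac conjI, assumption)
      (auto simp: fm(3,4) power_add algebra_simps)
next
  case (mult p q)
  then obtain f m f' m' where fm: "polynomial_in f" "polynomial_in f'"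
    "\<And>t. det (G t) \<noteq> 0 \<Longrightarrow> f t = det (G t) ^ m * p (conjugate (matrix_inv (G t)) (G t) (Y t))"
    "\<And>t. det (G t) \<noteq> 0 \<Longrightarrow> f' t = det (G t) ^ m' * q (conjugate (matrix_inv (G t)) (G t) (Y t))"
    by blast
  have "polynomial_in (\<lambda>t. f t * f' t)"
    by (intro polynomial_in_mult fm)
  then show ?case
    by (rule_tac exI, rule_tac exI[of _ "m + m'"], rule_tac conjI, assumption)
      (auto simp: fm(3,4) power_add algebra_simps)
qed

text \<open>Over a finite field, one plus the product of all factors \<open>X - a\<close> has no
  root.\<close>

lemma infinite_UNIV_alg_closed: "infinite (UNIV :: 'k::alg_closed_field set)"
proof
  assume fin: "finite (UNIV :: 'k set)"
  define P where "P = (\<Prod>a\<in>(UNIV :: 'k set). [:- a, 1:])"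
  have "degree P = card (UNIV :: 'k set)"
    unfolding P_def by (subst degree_prod_eq_sum_degree) auto
  then have "degree (P + 1) > 0"
    using fin by (simp add: degree_add_eq_left finite_UNIV_card_ge_0)
  then obtain z where "poly (P + 1) z = 0"
    using alg_closed_imp_poly_has_root by blast
  moreover have "poly P z = 0"
    using fin by (auto simp: P_def poly_prod)
  ultimately show False
    by simp
qed

text \<open>Two points are joined by a curve in the orbit. If \<open>p\<close> is nonzero at one end
  and \<open>q\<close> at the other, both are nonzero at some common parameter, because the field is
  infinite.\<close>

lemma irreducible_graded_orbit:
  fixes lev :: "'n::finite \<Rightarrow> nat"
  assumes R: "graded_orbit lev \<subseteq> R"
  shows "irreducible_in (subtopology zariski R) (graded_orbit lev :: ('k::alg_closed_field^'n^'n^'r) set)"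
  unfolding irreducible_in_def
proof (intro conjI allI impI)
  show "graded_orbit lev \<subseteq> topspace (subtopology zariski R)"
    using R by simp
  have "conjugate (mat 1) (mat 1) 0 \<in> (graded_orbit lev :: ('k^'n^'n^'r) set)"
    unfolding graded_orbit_def graded_def by force
  then show "graded_orbit lev \<noteq> ({} :: ('k^'n^'n^'r) set)"
    by blast
next
  fix A B :: "('k^'n^'n^'r) set"
  assume AB: "closedin (subtopology zariski R) A \<and> closedin (subtopology zariski R) B \<and> graded_orbit lev \<subseteq> A \<union> B"
  then obtain P Q where PQ: "P \<subseteq> polynomial_functions" "A = zero_locus P \<inter> R"
    "Q \<subseteq> polynomial_functions" "B = zero_locus Q \<inter> R"
    unfolding closedin_subtopology closedin_zariski by blast
  show "graded_orbit lev \<subseteq> A \<or> graded_orbit lev \<subseteq> B"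
  proof (rule ccontr)
    assume "\<not> ?thesis"
    then obtain x0 x1 where x: "x0 \<in> graded_orbit lev" "x0 \<notin> A" "x1 \<in> graded_orbit lev" "x1 \<notin> B"
      by blast
    then obtain p q where p: "p \<in> P" "p x0 \<noteq> 0" and q: "q \<in> Q" "q x1 \<noteq> 0"
      using PQ R unfolding zero_locus_def by blast
    obtain h0 g0 y0 where x0: "x0 = conjugate h0 g0 y0" "g0 ** h0 = mat 1" "y0 \<in> graded lev"
      using x unfolding graded_orbit_def by blast
    obtain h1 g1 y1 where x1: "x1 = conjugate h1 g1 y1" "g1 ** h1 = mat 1" "y1 \<in> graded lev"
      using x unfolding graded_orbit_def by blast
    \<comment> \<open>Gradedness is linear and persists along the line; invertibility fails at only
      finitely many parameters.\<close>
    define G where "G t = (\<chi> a b. g0 $ a $ b + t * (g1 $ a $ b - g0 $ a $ b))" for t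
    define Y where "Y t = (\<chi> i a b. y0 $ i $ a $ b + t * (y1 $ i $ a $ b - y0 $ i $ a $ b))" for t
    have ends: "G 0 = g0" "G 1 = g1" "Y 0 = y0" "Y 1 = y1"
      by (simp_all add: G_def Y_def vec_eq_iff)
    have G: "polynomial_in (\<lambda>t. G t $ a $ b)" for a b
      by (simp add: G_def polynomial_in_line)
    have Y: "polynomial_in (\<lambda>t. Y t $ i $ a $ b)" for i a b
      by (simp add: Y_def polynomial_in_line)
    have graded: "Y t \<in> graded lev" for t
      using x0(3) x1(3) unfolding graded_def Y_def
      by simp (metis add.right_neutral diff_self mult_zero_right)
    have inv: "matrix_inv g0 = h0" "matrix_inv g1 = h1" "det g0 \<noteq> 0" "det g1 \<noteq> 0"
      using right_inverse_matrix x0(2) x1(2) by blast+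
    obtain f m where f: "polynomial_in f" 
      "\<And>t. det (G t) \<noteq> 0 \<Longrightarrow> f t = det (G t) ^ m * p (conjugate (matrix_inv (G t)) (G t) (Y t))"
      using polynomial_on_conjugates[OF G Y subsetD[OF PQ(1) p(1)]] by blast
    obtain f' m' where f': "polynomial_in f'" 
      "\<And>t. det (G t) \<noteq> 0 \<Longrightarrow> f' t = det (G t) ^ m' * q (conjugate (matrix_inv (G t)) (G t) (Y t))"
      using polynomial_on_conjugates[OF G Y subsetD[OF PQ(3) q(1)]] by blast
    have nz: "det (G 0) \<noteq> 0" "f 0 \<noteq> 0" "f' 1 \<noteq> 0"
      using f(2)[of 0] f'(2)[of 1] p(2) q(2) by (simp_all add: ends inv x0(1) x1(1))
    have "polynomial_in (\<lambda>t. det (G t))"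
      by (rule polynomial_in_det[OF G])
    then obtain D F F' where D: "\<And>t. det (G t) = poly D t" "\<And>t. f t = poly F t" "\<And>t. f' t = poly F' t"
      using f(1) f'(1) unfolding polynomial_in_def by blast
    \<comment> \<open>Each factor is nonzero at 0 or at 1.\<close>
    have "D * F * F' \<noteq> 0"
      using nz unfolding D by auto
    then have "finite {t. poly (D * F * F') t = 0}"
      by (rule poly_roots_finite)
    then obtain t where "poly (D * F * F') t \<noteq> 0"
      using infinite_UNIV_alg_closed[where 'k = 'k] by (metis (mono_tags, lifting) UNIV_eq_I mem_Collect_eq)
    then have t: "det (G t) \<noteq> 0" "f t \<noteq> 0" "f' t \<noteq> 0"
      by (auto simp: D)
    let ?x = "conjugate (matrix_inv (G t)) (G t) (Y t)"
    have "p ?x \<noteq> 0" "q ?x \<noteq> 0"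
      using t f(2) f'(2) by auto
    moreover have "?x \<in> graded_orbit lev"
      unfolding graded_orbit_def using graded t(1) matrix_inv_mult by blast
    ultimately show False
      using AB PQ p(1) q(1) unfolding zero_locus_def by blast
  qed
qed

section \<open>Adapted bases\<close>

text \<open>The subspaces \<open>ann m\<close> increase with \<open>m\<close>, and each arrow maps
  one into the preceding one. Bases are extended along them, \<open>dep b\<close> recording the
  stage at which \<open>b\<close> enters.\<close>

lemma adapted_basis_step:
  fixes x :: "'k::field^'n^'n^'r"
  defines "ann m \<equiv> {v. \<forall>p. length (arrows p) = m \<longrightarrow> path_matrix x p *v v = 0}"
  shows "\<exists>B dep. vec.independent B \<and> vec.span B = ann m \<and>
    (\<forall>b\<in>B. dep b < m \<and> (\<forall>i. x $ i *v b \<in> vec.span {c \<in> B. dep c < dep b}))"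
proof (induction m)
  case 0
  have "ann 0 = {0}"
    unfolding ann_def by (auto dest: spec[of _ "Path []"])
  then show ?case
    by (intro exI[of _ "{}"]) (simp add: vec.independent_empty)
next
  case (Suc m)
  then obtain B dep where B: "vec.independent B" "vec.span B = ann m"
    "\<And>b. b \<in> B \<Longrightarrow> dep b < m" "\<And>b i. b \<in> B \<Longrightarrow> x $ i *v b \<in> vec.span {c \<in> B. dep c < dep b}"
    by blast
  have down: "x $ i *v v \<in> ann m" if "v \<in> ann (Suc m)" for i v
    unfolding ann_def
  proof (intro CollectI allI impI)
    fix p :: "'r quiver_path" assume "length (arrows p) = m"
    then have "path_matrix x (p + Path [i]) *v v = 0"
      using that by (simp add: ann_def length_arrows_plus)
    then show "path_matrix x p *v (x $ i *v v) = 0"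
      by (simp add: path_matrix_add path_matrix_Cons matrix_vector_mul_assoc)
  qed
  have "ann m \<subseteq> ann (Suc m)"
  proof
    fix v assume v: "v \<in> ann m"
    have "path_matrix x (Path w) *v v = 0" if "length w = Suc m" for w
      using v that by (cases w) (simp_all add: ann_def path_matrix_Cons matrix_vector_mul_assoc[symmetric])
    then have "path_matrix x p *v v = 0" if "length (arrows p) = Suc m" for p
      using that by (cases p) simp
    then show "v \<in> ann (Suc m)"
      by (simp add: ann_def)
  qed
  then have "B \<subseteq> ann (Suc m)"
    using B(2) vec.span_superset by blast
  then obtain B' where B': "B \<subseteq> B'" "B' \<subseteq> ann (Suc m)" "vec.independent B'" "ann (Suc m) \<subseteq> vec.span B'"
    using vec.maximal_independent_subset_extend[OF _ B(1)] by blast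
  have sub: "vec.subspace (ann (Suc m))"
    unfolding ann_def
    by (rule vec.subspaceI) (auto simp: matrix_vector_right_distrib vector_scalar_commute)
  define dep' where "dep' b = (if b \<in> B then dep b else m)" for b
  show ?case
  proof (intro exI[of _ B'] exI[of _ dep'] conjI ballI allI)
    show "vec.span B' = ann (Suc m)"
      using B' sub vec.span_minimal by blast
    fix b assume b: "b \<in> B'"
    show "dep' b < Suc m"
      using B(3) by (auto simp: dep'_def less_Suc_eq)
    fix i
    show "x $ i *v b \<in> vec.span {c \<in> B'. dep' c < dep' b}"
    proof (cases "b \<in> B")
      case True
      have "{c \<in> B. dep c < dep b} \<subseteq> {c \<in> B'. dep' c < dep' b}"
        using True B'(1) by (auto simp: dep'_def)
      then show ?thesis
        using B(4)[OF True] vec.span_mono by blast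
    next
      case False
      have "B \<subseteq> {c \<in> B'. dep' c < dep' b}"
        using False B'(1) B(3) by (auto simp: dep'_def)
      moreover have "x $ i *v b \<in> vec.span B"
        using down b B'(2) B(2) by blast
      ultimately show ?thesis
        using vec.span_mono by blast
    qed
  qed (fact B'(3))
qed

text \<open>At stage \<open>L + 1\<close> the annihilator is the whole space. Its adapted basis,
  taken as the columns of \<open>g\<close>, makes the matrices graded.\<close>

lemma exists_graded_orbit:
  fixes x :: "'k::field^'n^'n^'r"
  assumes x: "x \<in> rep_variety L"
  shows "\<exists>lev. (\<forall>a. lev a \<le> L) \<and> x \<in> graded_orbit lev"
proof -
  have ann: "{v. \<forall>p. length (arrows p) = L + 1 \<longrightarrow> path_matrix x p *v v = 0} = UNIV"
    using x by (simp add: rep_variety_def)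
  obtain B dep where B_dep: "vec.independent B" "vec.span B = UNIV"
    "\<forall>b\<in>B. dep b < L + 1 \<and> (\<forall>i. x $ i *v b \<in> vec.span {c \<in> B. dep c < dep b})"
    using adapted_basis_step[where m = "L + 1" and x = x] unfolding ann by blast
  then have B: "vec.independent B" "vec.span B = UNIV"
    "\<And>b. b \<in> B \<Longrightarrow> dep b < L + 1" "\<And>b i. b \<in> B \<Longrightarrow> x $ i *v b \<in> vec.span {c \<in> B. dep c < dep b}"
    by blast+
  have fin: "finite B"
    using B(1) by (rule vec.finiteI_independent)
  have "card B = vec.dim (UNIV :: ('k^'n) set)"
    by (rule vec.basis_card_eq_dim) (use B in auto)
  then have "card (UNIV :: 'n set) = card B"
    by (simp add: card_cart_basis)
  then obtain f where f: "bij_betw f (UNIV :: 'n set) B"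
    using finite_same_card_bij[OF finite_class.finite_UNIV fin] by blast
  then have fB: "f a \<in> B" for a
    by (auto simp: bij_betw_def)
  define g :: "'k^'n^'n" where "g = (\<chi> i a. f a $ i)"
  have col: "column a g = f a" for a
    by (simp add: g_def column_def vec_eq_iff)
  have "columns g = B"
    using f by (auto simp: columns_def col bij_betw_def)
  then obtain h where gh: "g ** h = mat 1"
    using B(2) matrix_right_invertible_span_columns[of g] by auto
  then have hg: "h ** g = mat 1"
    using matrix_left_right_inverse by blast
  have col_mult: "A *v axis b 1 = column b A" for A :: "'k^'n^'n" and b
    by (simp add: vec_eq_iff matrix_vector_mult_def column_def axis_def if_distrib cong: if_cong)
  have hf: "h *v f a = axis a 1" for a
  proof -
    have "h *v (g *v axis a 1) = axis a 1"
      by (simp add: matrix_vector_mul_assoc hg)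
    then show ?thesis
      by (simp add: col_mult col)
  qed
  \<comment> \<open>Arrows lower the depth, so the level is its complement; depths are at most
    \<open>L\<close>, so the subtraction is not cut off.\<close>
  define lev where "lev a = L - dep (f a)" for a
  have "conjugate h g x \<in> graded lev"
    unfolding graded_def
  proof (intro CollectI allI impI)
    fix i a b assume nz: "conjugate h g x $ i $ a $ b \<noteq> 0"
    have "conjugate h g x $ i $ a $ b = (conjugate h g x $ i *v axis b 1) $ a"
      by (simp add: col_mult column_def)
    also have "\<dots> = (h *v (x $ i *v f b)) $ a"
      by (simp only: conjugate_def vec_lambda_beta matrix_vector_mul_assoc[symmetric] col_mult[of g] col)
    finally have nz': "(h *v (x $ i *v f b)) $ a \<noteq> 0"
      using nz by simp
    \<comment> \<open>Row \<open>a\<close> of \<open>h\<close> reads off the coefficient of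
      \<open>f a\<close> in the adapted basis.\<close>
    have "(h *v v) $ a = 0" if "v \<in> vec.span {c \<in> B. dep c < dep (f b)}" "\<not> dep (f a) < dep (f b)" for v
      using that(1)
    proof (induction rule: vec.span_induct)
      show "vec.subspace {v. (h *v v) $ a = 0}"
        by (rule vec.subspaceI) (auto simp: matrix_vector_right_distrib vector_scalar_commute)
    next
      fix c assume c: "c \<in> {c \<in> B. dep c < dep (f b)}"
      then obtain e where "c = f e"
        using f by (auto simp: bij_betw_def)
      then show "(h *v c) $ a = 0"
        using c that(2) by (auto simp: hf axis_def)
    qed
    then have "dep (f a) < dep (f b)"
      using B(4)[OF fB] nz' by blast
    moreover have "dep (f b) \<le> L"
      using B(3)[OF fB] by (simp add: less_Suc_eq_le)
    ultimately show "lev b < lev a"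
      unfolding lev_def by linarith
  qed
  moreover have "x = conjugate g h (conjugate h g x)"
  proof -
    have "g ** (h ** A ** g) ** h = A" for A :: "'k^'n^'n"
      by (metis gh matrix_mul_assoc matrix_mul_lid matrix_mul_rid)
    then show ?thesis
      by (simp add: conjugate_def vec_eq_iff)
  qed
  ultimately have "x \<in> graded_orbit lev"
    unfolding graded_orbit_def using hg by blast
  moreover have "lev a \<le> L" for a
    by (simp add: lev_def)
  ultimately show ?thesis by blast
qed

section \<open>Level functions\<close>

lemma graded_orbit_mono:
  assumes "\<And>a b. lev a < lev b \<Longrightarrow> lev' a < lev' b"
  shows "graded_orbit lev \<subseteq> graded_orbit lev'"
  unfolding graded_orbit_def graded_def using assms by blast

text \<open>With fewer levels than indices, some level holds two of them; raising one, together with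
  everything above, creates a new level.\<close>

lemma level_refine_step:
  fixes lev :: "'n::finite \<Rightarrow> nat"
  assumes range: "range lev = {..<k}" and k: "k < CARD('n)"
  shows "\<exists>lev'. range lev' = {..<Suc k} \<and> (\<forall>a b. lev a < lev b \<longrightarrow> lev' a < lev' b)"
proof -
  have "\<not> inj lev"
    using range k card_image[of lev UNIV] by auto
  then obtain a b where ab: "a \<noteq> b" "lev a = lev b"
    unfolding inj_def by blast
  \<comment> \<open>\<open>b\<close> keeps the old level occupied while \<open>a\<close> opens the
    next one.\<close>
  define lev' where "lev' c = (if lev a < lev c \<or> c = a then Suc (lev c) else lev c)" for c
  have la: "lev a < k"
    using range by auto
  have "j \<in> range lev'" if "j < Suc k" for j
  proof -
    consider "j < lev a" | "j = lev a" | "j = Suc (lev a)" | i where "j = Suc i" "lev a < i"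
      by (metis Suc_lessI linorder_neqE_nat not0_implies_Suc not_less_eq zero_less_Suc less_imp_Suc_add)
    then show ?thesis
    proof cases
      case 1
      then have "j \<in> range lev"
        using la range by auto
      then obtain c where "j = lev c" by blast
      then have "j = lev' c"
        using 1 by (auto simp: lev'_def)
      then show ?thesis by blast
    next
      case 2
      then have "j = lev' b"
        using ab by (simp add: lev'_def)
      then show ?thesis by blast
    next
      case 3
      then have "j = lev' a"
        by (simp add: lev'_def)
      then show ?thesis by blast
    next
      case 4
      then have "i \<in> range lev"
        using that range by auto
      then obtain c where "i = lev c" by blast
      then have "j = lev' c"
        using 4 by (simp add: lev'_def)
      then show ?thesis by blast
    qed
  qed
  moreover have "lev' c < Suc k" for c
  proof -
    have "lev c < k"
      using range by auto
    then show ?thesis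
      by (simp add: lev'_def)
  qed
  ultimately have "range lev' = {..<Suc k}"
    by auto
  moreover have "\<forall>c d. lev c < lev d \<longrightarrow> lev' c < lev' d"
    using ab by (auto simp: lev'_def)
  ultimately show ?thesis by blast
qed

text \<open>Ranking squeezes out the empty levels; then levels are split one at a time until there
  are \<open>L + 1\<close>. This makes the flag strict.\<close>

lemma level_refine:
  fixes lev :: "'n::finite \<Rightarrow> nat"
  assumes le: "\<And>a. lev a \<le> L" and card: "L + 1 \<le> CARD('n)"
  shows "\<exists>lev'. range lev' = {..L} \<and> (\<forall>a b. lev a < lev b \<longrightarrow> lev' a < lev' b)"
proof -
  define k0 where "k0 = card (range lev)"
  obtain h where h: "bij_betw h {..<k0} (range lev)" "strict_mono_on {..<k0} h"
    using ex_bij_betw_strict_mono_card[of "range lev"] unfolding k0_def by auto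
  define rank where "rank a = the_inv_into {..<k0} h (lev a)" for a
  have inj: "inj_on h {..<k0}" "h ` {..<k0} = range lev"
    using h(1) by (auto simp: bij_betw_def)
  have rank: "rank a < k0" "h (rank a) = lev a" for a
    using the_inv_into_into[OF inj(1), of "lev a" "{..<k0}"] f_the_inv_into_f[OF inj(1), of "lev a"] inj(2)
    unfolding rank_def by auto
  have rank_range: "range rank = {..<k0}"
  proof
    show "{..<k0} \<subseteq> range rank"
    proof
      fix j assume j: "j \<in> {..<k0}"
      then obtain a where "h j = lev a"
        using inj(2) by blast
      then have "rank a = j"
        using inj_onD[OF inj(1), of "rank a" j] j rank[of a] by simp
      then show "j \<in> range rank" by blast
    qed
  qed (use rank(1) in auto)
  have rank_less: "rank a < rank b" if "lev a < lev b" for a b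
    using h(2) rank that by (metis lessThan_iff linorder_less_linear order_less_asym strict_mono_onD)
  have "k0 \<le> L + 1"
    using card_mono[of "{..L}" "range lev"] le unfolding k0_def by auto
  then have "\<exists>lev'. range lev' = {..<L + 1} \<and> (\<forall>a b. lev a < lev b \<longrightarrow> lev' a < lev' b)"
  proof (rule dec_induct)
    show "\<exists>lev'. range lev' = {..<k0} \<and> (\<forall>a b. lev a < lev b \<longrightarrow> lev' a < lev' b)"
      using rank_range rank_less by blast
  next
    fix k assume k: "k0 \<le> k" "k < L + 1"
      "\<exists>lev'. range lev' = {..<k} \<and> (\<forall>a b. lev a < lev b \<longrightarrow> lev' a < lev' b)"
    then obtain lev' where "range lev' = {..<k}" "\<forall>a b. lev a < lev b \<longrightarrow> lev' a < lev' b"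
      by blast
    moreover have "k < CARD('n)"
      using k(2) card by simp
    ultimately show "\<exists>lev'. range lev' = {..<Suc k} \<and> (\<forall>a b. lev a < lev b \<longrightarrow> lev' a < lev' b)"
      using level_refine_step[of lev' k] by meson
  qed
  then show ?thesis
    by (simp add: lessThan_Suc_atMost)
qed

section \<open>Exchange of basis vectors between adjacent levels\<close>

lemma underdetermined_system:
  fixes c :: "'e \<Rightarrow> 'a \<Rightarrow> 'k::field"
  assumes "finite E" "finite A" "card E < card A"
  shows "\<exists>v. (\<exists>a\<in>A. v a \<noteq> 0) \<and> (\<forall>e\<in>E. (\<Sum>a\<in>A. c e a * v a) = 0)"
  using assms
proof (induction E arbitrary: A c rule: finite_induct)
  case empty
  then show ?case
    by (intro exI[of _ "\<lambda>_. 1"]) (auto simp: card_gt_0_iff)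
next
  case (insert e E)
  show ?case
  proof (cases "\<forall>a\<in>A. c e a = 0")
    case True
    then show ?thesis
      using insert.IH[of A c] insert.prems insert.hyps by auto
  next
    case False
    then obtain a0 where a0: "a0 \<in> A" "c e a0 \<noteq> 0" by blast
    let ?A = "A - {a0}"
    have "card E < card ?A"
      using insert.prems insert.hyps a0 by simp
    then obtain v where v: "\<exists>a\<in>?A. v a \<noteq> 0"
      "\<And>e'. e' \<in> E \<Longrightarrow> (\<Sum>a\<in>?A. (c e' a - c e' a0 * c e a / c e a0) * v a) = 0"
      using insert.IH[of ?A "\<lambda>e' a. c e' a - c e' a0 * c e a / c e a0"] insert.prems by auto
    \<comment> \<open>The value that equation \<open>e\<close> forces on the eliminated unknown
      \<open>a0\<close>.\<close>
    define s where "s = - (\<Sum>a\<in>?A. c e a * v a) / c e a0"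
    define w where "w = v(a0 := s)"
    have split: "(\<Sum>a\<in>A. c e' a * w a) = c e' a0 * s + (\<Sum>a\<in>?A. c e' a * v a)" for e'
      using sum.remove[OF insert.prems(1) a0(1), of "\<lambda>a. c e' a * w a"] by (simp add: w_def)
    have "(\<Sum>a\<in>A. c e' a * w a) = 0" if "e' \<in> E" for e'
    proof -
      have "0 = (\<Sum>a\<in>?A. c e' a * v a - c e' a0 / c e a0 * (c e a * v a))"
        using v(2)[OF that] by (simp add: algebra_simps)
      also have "\<dots> = (\<Sum>a\<in>?A. c e' a * v a) - c e' a0 / c e a0 * (\<Sum>a\<in>?A. c e a * v a)"
        by (simp add: sum_subtractf sum_distrib_left)
      finally show ?thesis
        by (simp add: split s_def)
    qed
    moreover have "(\<Sum>a\<in>A. c e a * w a) = 0"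
      using a0(2) by (simp add: split s_def)
    moreover have "\<exists>a\<in>A. w a \<noteq> 0"
      using v(1) by (auto simp: w_def)
    ultimately show ?thesis by blast
  qed
qed

text \<open>
  If level \<open>l\<close> is so large that some nonzero vector \<open>v\<close> in it is sent by all matrices beyond level
  \<open>l + 1\<close>, then a basis vector of level \<open>l\<close> can be replaced by \<open>v\<close>, which moves to level \<open>l + 1\<close>.
\<close>

lemma graded_orbit_raise:
  fixes x :: "'k::field^'n^'n^'r"
  assumes x: "x \<in> graded_orbit lev"
    and card: "CARD('r) * card {a. lev a = Suc l} < card {a. lev a = l}"
  shows "\<exists>a. lev a = l \<and> x \<in> graded_orbit (lev(a := Suc l))"
proof -
  obtain h g y where y: "x = conjugate h g y" "g ** h = mat 1" "y \<in> graded lev"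
    using x unfolding graded_orbit_def by blast
  \<comment> \<open>The unknowns are the coefficients of \<open>v\<close> on level \<open>l\<close>;
    each arrow and each index of level \<open>Suc l\<close> contribute one equation.\<close>
  let ?A = "{a. lev a = l}" and ?E = "(UNIV :: 'r set) \<times> {a. lev a = Suc l}"
  have "card ?E < card ?A"
    using card by (simp add: card_cartesian_product)
  then have "\<exists>v. (\<exists>a\<in>?A. v a \<noteq> 0) \<and> (\<forall>e\<in>?E. (\<Sum>a\<in>?A. y $ fst e $ snd e $ a * v a) = 0)"
    by (intro underdetermined_system) auto
  then obtain v0 where v0: "\<exists>a\<in>?A. v0 a \<noteq> 0" "\<forall>e\<in>?E. (\<Sum>a\<in>?A. y $ fst e $ snd e $ a * v0 a) = 0"
    by blast
  then obtain a0 where a0: "lev a0 = l" "v0 a0 \<noteq> 0" by blast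
  \<comment> \<open>Coefficient 1 at \<open>a0\<close> lets \<open>v\<close> replace that basis
    vector.\<close>
  define v where "v a = (if lev a = l then v0 a / v0 a0 else 0)" for a
  have v_a0: "v a0 = 1"
    using a0 by (simp add: v_def)
  have v_supp: "lev a = l" if "v a \<noteq> 0" for a
    using that by (auto simp: v_def split: if_splits)
  \<comment> \<open>\<open>w i\<close> is the image of \<open>v\<close> under arrow
    \<open>i\<close>; gradedness and the equations push it above level \<open>Suc l\<close>.\<close>
  define w where "w i b = (\<Sum>a\<in>UNIV. y $ i $ b $ a * v a)" for i b
  have w_eq: "w i b = (\<Sum>a\<in>?A. y $ i $ b $ a * v0 a) / v0 a0" for i b
    unfolding w_def by (simp add: v_def if_distrib sum.If_cases sum_divide_distrib cong: if_cong)
  have w_supp: "Suc l < lev b" if nz: "w i b \<noteq> 0" for i b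
  proof -
    obtain a where "y $ i $ b $ a * v a \<noteq> 0"
      using sum.not_neutral_contains_not_neutral[OF nz[unfolded w_def]] by blast
    then have "lev a < lev b" "lev a = l"
      using y(3) v_supp by (auto simp: graded_def)
    moreover have "lev b \<noteq> Suc l"
      using that bspec[OF v0(2), of "(i, b)"] by (auto simp: w_eq)
    ultimately show ?thesis by simp
  qed
  \<comment> \<open>Column \<open>a0\<close> of \<open>m\<close> is \<open>v\<close>. Since
    \<open>d\<close> vanishes at \<open>a0\<close>, changing its sign gives the inverse
    \<open>m'\<close>.\<close>
  define d where "d a = (if a = a0 then 0 else v a)" for a
  define m :: "'k^'n^'n" where "m = (\<chi> a b. (if a = b then 1 else 0) + (if b = a0 then d a else 0))"
  define m' :: "'k^'n^'n" where "m' = (\<chi> a b. (if a = b then 1 else 0) - (if b = a0 then d a else 0))"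
  have left: "(m' ** M) $ a $ b = M $ a $ b - d a * M $ a0 $ b" for M :: "'k^'n^'n" and a b
    unfolding matrix_matrix_mult_def m'_def
    by (simp add: left_diff_distrib sum_subtractf if_distrib[where f = "\<lambda>t. t * _"] sum.delta cong: if_cong)
  have right: "(M ** m) $ a $ b = (if b = a0 then (\<Sum>c\<in>UNIV. M $ a $ c * v c) else M $ a $ b)" for M :: "'k^'n^'n" and a b
  proof -
    have "(if c = b then 1 else 0) + (if b = a0 then d c else 0) = (if b = a0 then v c else if c = b then 1 else 0)" for c
      using v_a0 by (auto simp: d_def)
    then show ?thesis
      unfolding matrix_matrix_mult_def m_def
      by (simp add: if_distrib[where f = "\<lambda>t. _ * t"] sum.delta cong: if_cong)
  qed
  have "m' ** m = mat 1"
    by (simp add: vec_eq_iff left) (simp add: m_def mat_def d_def)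
  then have mm': "m ** m' = mat 1"
    using matrix_left_right_inverse by blast
  let ?lev = "lev(a0 := Suc l)"
  have "conjugate m' m y \<in> graded ?lev"
    unfolding graded_def
  proof (intro CollectI allI impI)
    fix i a b assume nz: "conjugate m' m y $ i $ a $ b \<noteq> 0"
    have eq: "conjugate m' m y $ i $ a $ b = (y $ i ** m) $ a $ b - d a * (y $ i ** m) $ a0 $ b"
      by (simp add: conjugate_def left matrix_mul_assoc[symmetric])
    have nz': "(if b = a0 then w i a - d a * w i a0 else y $ i $ a $ b - d a * y $ i $ a0 $ b) \<noteq> 0"
      using nz unfolding eq right w_def by (cases "b = a0") simp_all
    show "?lev b < ?lev a"
    proof (cases "b = a0")
      case True
      have "w i a0 = 0"
        using w_supp[of i a0] a0(1) by auto
      then have "w i a \<noteq> 0"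
        using nz' True by simp
      then show ?thesis
        using True w_supp a0(1) by fastforce
    next
      case False
      then have "y $ i $ a $ b \<noteq> 0 \<or> (d a \<noteq> 0 \<and> y $ i $ a0 $ b \<noteq> 0)"
        using nz' by auto
      then show ?thesis
      proof
        assume "y $ i $ a $ b \<noteq> 0"
        then have "lev b < lev a"
          using y(3) by (auto simp: graded_def)
        then show ?thesis
          using False a0(1) by auto
      next
        \<comment> \<open>Row \<open>a0\<close> is subtracted only from other rows of level
          \<open>l\<close>, which keep their level.\<close>
        assume *: "d a \<noteq> 0 \<and> y $ i $ a0 $ b \<noteq> 0"
        then have "lev b < l" "a \<noteq> a0" "lev a = l"
          using y(3) a0(1) v_supp by (auto simp: graded_def d_def split: if_splits)
        then show ?thesis
          using False by simp
      qed
    qed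
  qed
  moreover have "x = conjugate (h ** m) (m' ** g) (conjugate m' m y)"
  proof -
    have "h ** m ** (m' ** A ** m) ** (m' ** g) = h ** A ** g" for A
      by (metis mm' matrix_mul_assoc matrix_mul_lid matrix_mul_rid)
    then show ?thesis
      by (simp add: y(1) conjugate_def)
  qed
  moreover have "(m' ** g) ** (h ** m) = mat 1"
    using y(2) \<open>m' ** m = mat 1\<close> by (metis matrix_mul_assoc matrix_mul_rid)
  ultimately have "x \<in> graded_orbit ?lev"
    unfolding graded_orbit_def by blast
  then show ?thesis
    using a0(1) by blast
qed

text \<open>Passing to the dual module reverses flags, so raising a level turns into lowering
  one.\<close>

definition transpose_rep :: "'k^'n^'n^'r \<Rightarrow> 'k^'n^'n^'r" where
  "transpose_rep x = (\<chi> i. transpose (x $ i))"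

lemma transpose_rep_orbit:
  assumes x: "(x :: 'k::field^'n^'n^'r) \<in> graded_orbit lev" and le: "\<And>a. lev a \<le> L"
  shows "transpose_rep x \<in> graded_orbit (\<lambda>a. L - lev a)"
proof -
  obtain h g y where y: "x = conjugate h g y" "g ** h = mat 1" "y \<in> graded lev"
    using x unfolding graded_orbit_def by blast
  have "L - lev b < L - lev a" if "lev a < lev b" for a b
    using le[of b] that by linarith
  then have "transpose_rep y \<in> graded (\<lambda>a. L - lev a)"
    using y(3) unfolding graded_def transpose_rep_def transpose_def by auto
  moreover have "transpose_rep x = conjugate (transpose g) (transpose h) (transpose_rep y)"
    by (simp add: y(1) transpose_rep_def conjugate_def matrix_transpose_mul matrix_mul_assoc)
  moreover have "transpose h ** transpose g = mat 1"
    by (simp add: matrix_transpose_mul[symmetric] y(2) transpose_mat)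
  ultimately show ?thesis
    unfolding graded_orbit_def by blast
qed

text \<open>Dual to \<open>graded_orbit_raise\<close>, which is applied to the transposed point with
  levels \<open>L - lev a\<close>.\<close>

lemma graded_orbit_lower:
  fixes x :: "'k::field^'n^'n^'r"
  assumes x: "x \<in> graded_orbit lev" and le: "\<And>a. lev a \<le> L" and l: "Suc l \<le> L"
    and card: "CARD('r) * card {a. lev a = l} < card {a. lev a = Suc l}"
  shows "\<exists>a. lev a = Suc l \<and> x \<in> graded_orbit (lev(a := l))"
proof -
  let ?lev = "\<lambda>a. L - lev a"
  have eq: "L - lev a = L - j \<longleftrightarrow> lev a = j" if "j \<le> L" for a j
    using le[of a] that by auto
  have "Suc (L - Suc l) = L - l"
    using l by simp
  then have "CARD('r) * card {a. ?lev a = Suc (L - Suc l)} < card {a. ?lev a = L - Suc l}"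
    using card l by (simp add: eq)
  then obtain a where a: "?lev a = L - Suc l" "transpose_rep x \<in> graded_orbit (?lev(a := Suc (L - Suc l)))"
    using graded_orbit_raise[OF transpose_rep_orbit[OF x le]] by blast
  have "transpose_rep (transpose_rep x) \<in> graded_orbit (\<lambda>b. L - (?lev(a := Suc (L - Suc l))) b)"
    by (rule transpose_rep_orbit[OF a(2)]) (use l in auto)
  moreover have "(\<lambda>b. L - (?lev(a := Suc (L - Suc l))) b) = lev(a := l)"
    using le l by (auto simp: fun_eq_iff)
  moreover have "transpose_rep (transpose_rep x) = x"
    by (simp add: transpose_rep_def vec_eq_iff transpose_def)
  ultimately show ?thesis
    using a(1) eq[OF l] by auto
qed

text \<open>
  Both moves above even out the level sizes, so a strict flag minimising this sum is balanced.
\<close>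

definition level_energy :: "('n \<Rightarrow> nat) \<Rightarrow> nat \<Rightarrow> nat" where
  "level_energy lev L = (\<Sum>l\<le>L. (card {a. lev a = l})\<^sup>2)"

text \<open>With level sizes \<open>p + q + 2\<close> and \<open>p\<close>, the sum of squares drops
  by \<open>2 * q + 2\<close>. The larger level has at least two elements, so it does not become
  empty.\<close>

lemma level_energy_move:
  fixes lev :: "'n::finite \<Rightarrow> nat"
  assumes range: "range lev = {..L}" and a: "lev a = l" and m: "m \<le> L"
    and card: "card {b. lev b = m} + 2 \<le> card {b. lev b = l}"
  shows "level_energy (lev(a := m)) L < level_energy lev L" and "range (lev(a := m)) = {..L}"
proof -
  let ?lev = "lev(a := m)"
  have ne: "l \<noteq> m"
    using card by auto
  have l: "l \<le> L"
    using range a by auto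
  have "{b. ?lev b = l} = {b. lev b = l} - {a}"
    using ne by auto
  then have cl: "card {b. ?lev b = l} = card {b. lev b = l} - 1"
    using a by simp
  have "{b. ?lev b = m} = insert a {b. lev b = m}"
    by auto
  then have cm: "card {b. ?lev b = m} = card {b. lev b = m} + 1"
    using a ne by simp
  have co: "{b. ?lev b = j} = {b. lev b = j}" if "j \<noteq> l" "j \<noteq> m" for j
    using that a by auto
  have split: "level_energy f L = (card {b. f b = l})\<^sup>2 + (card {b. f b = m})\<^sup>2
      + (\<Sum>j\<in>{..L} - {l} - {m}. (card {b. f b = j})\<^sup>2)" for f :: "'n \<Rightarrow> nat"
    unfolding level_energy_def using l m ne
    by (subst sum.remove[of _ l]; simp; subst sum.remove[of _ m]; simp)
  define p where "p = card {b. lev b = m}"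
  define q where "q = card {b. lev b = l} - p - 2"
  have q: "card {b. lev b = l} = p + q + 2"
    using card by (simp add: p_def q_def)
  have "(p + q + 1)\<^sup>2 + (p + 1)\<^sup>2 < (p + q + 2)\<^sup>2 + p\<^sup>2"
    by (simp add: power2_eq_square algebra_simps)
  moreover have "(\<Sum>j\<in>{..L} - {l} - {m}. (card {b. ?lev b = j})\<^sup>2) =
      (\<Sum>j\<in>{..L} - {l} - {m}. (card {b. lev b = j})\<^sup>2)"
    by (rule sum.cong) (use co in auto)
  ultimately show "level_energy ?lev L < level_energy lev L"
    unfolding split cl cm q p_def[symmetric] by simp
  have "card ({b. lev b = l} - {a}) \<noteq> 0"
    using a card by simp
  then have "{b. lev b = l} - {a} \<noteq> {}"
    by (metis card.empty)
  then obtain b where b: "lev b = l" "b \<noteq> a" by blast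
  show "range ?lev = {..L}"
  proof
    show "range ?lev \<subseteq> {..L}"
      using range m by auto
    show "{..L} \<subseteq> range ?lev"
    proof
      fix j assume "j \<in> {..L}"
      then obtain c where c: "lev c = j"
        using range by (metis imageE)
      show "j \<in> range ?lev"
      proof (cases "c = a")
        case True
        then have "?lev b = j"
          using b c a by simp
        then show ?thesis by blast
      next
        case False
        then have "?lev c = j"
          using c by simp
        then show ?thesis by blast
      qed
    qed
  qed
qed

definition balanced :: "nat \<Rightarrow> nat \<Rightarrow> ('n \<Rightarrow> nat) \<Rightarrow> bool" where
  "balanced r L lev \<longleftrightarrow> range lev = {..L} \<and> (\<forall>l<L.
     card {a. lev a = l} \<le> r * card {a. lev a = Suc l} \<and>
     card {a. lev a = Suc l} \<le> r * card {a. lev a = l})"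

text \<open>A violated inequality would permit an exchange that lowers the energy, so an energy
  minimiser among the strict flags of \<open>x\<close> is balanced.\<close>

lemma exists_balanced_orbit:
  fixes x :: "'k::field^'n^'n^'r"
  assumes x: "x \<in> rep_variety L" and r: "2 \<le> CARD('r)" and n: "L + 1 \<le> CARD('n)"
  shows "\<exists>lev. balanced CARD('r) L lev \<and> x \<in> graded_orbit lev"
proof -
  let ?P = "\<lambda>lev. range lev = {..L} \<and> x \<in> graded_orbit lev"
  obtain lev0 where lev0: "\<And>a. lev0 a \<le> L" "x \<in> graded_orbit lev0"
    using exists_graded_orbit[OF x] by blast
  obtain lev1 where "range lev1 = {..L} \<and> (\<forall>a b. lev0 a < lev0 b \<longrightarrow> lev1 a < lev1 b)"
    using level_refine[OF lev0(1) n] by (rule exE)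
  then have lev1: "range lev1 = {..L}" "\<And>a b. lev0 a < lev0 b \<Longrightarrow> lev1 a < lev1 b"
    by simp_all
  have "graded_orbit lev0 \<subseteq> (graded_orbit lev1 :: ('k^'n^'n^'r) set)"
    by (rule graded_orbit_mono) (fact lev1(2))
  then have "?P lev1"
    using lev1(1) lev0(2) by blast
  then obtain lev where lev: "?P lev" "\<And>lev'. ?P lev' \<Longrightarrow> level_energy lev L \<le> level_energy lev' L"
    using ex_has_least_nat[of ?P _ "\<lambda>lev. level_energy lev L"] by blast
  have range: "range lev = {..L}"
    using lev(1) by blast
  have pos: "0 < card {a. lev a = j}" if "j \<le> L" for j
  proof -
    have "j \<in> range lev"
      using that range by simp
    then show ?thesis
      by (auto simp: card_gt_0_iff)
  qed
  have no_move: False if "lev a = l" "m \<le> L" "CARD('r) * card {b. lev b = m} < card {b. lev b = l}"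
      "x \<in> graded_orbit (lev(a := m))" for a l m
  proof -
    \<comment> \<open>As there are at least two arrows and level \<open>m\<close> is nonempty, the
      strict inequality leaves the gap of two that an energy drop requires.\<close>
    have "2 * card {b. lev b = m} \<le> CARD('r) * card {b. lev b = m}"
      using r by simp
    then have "card {b. lev b = m} + 2 \<le> card {b. lev b = l}"
      using that(3) pos[OF that(2)] by linarith
    then have "level_energy (lev(a := m)) L < level_energy lev L" "range (lev(a := m)) = {..L}"
      using level_energy_move[OF range that(1,2)] by blast+
    then show False
      using lev(2)[of "lev(a := m)"] that(4) by auto
  qed
  have le: "lev a \<le> L" for a
    using range by auto
  have "balanced CARD('r) L lev"
    unfolding balanced_def
  proof (intro conjI allI impI)
    fix l assume l: "l < L"
    show "card {a. lev a = l} \<le> CARD('r) * card {a. lev a = Suc l}"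
    proof (rule ccontr)
      assume "\<not> ?thesis"
      then show False
        using graded_orbit_raise[of x lev l] lev(1) no_move[of _ l "Suc l"] l by auto
    qed
    show "card {a. lev a = Suc l} \<le> CARD('r) * card {a. lev a = l}"
    proof (rule ccontr)
      assume "\<not> ?thesis"
      then show False
        using graded_orbit_lower[of x lev L l] le lev(1) no_move[of _ "Suc l" l] l by auto
    qed
  qed (fact range)
  then show ?thesis
    using lev(1) by blast
qed

section \<open>A point in general position\<close>

text \<open>
  In the 0/1 point built from this relation every basis vector of positive level is the image of a
  basis vector under some arrow, and every coordinate form of level below \<open>L\<close> is the pullback of a
  coordinate form along some arrow; balancedness makes both possible.
\<close>

lemma balanced_matching:
  fixes lev :: "'n::finite \<Rightarrow> nat"
  assumes bal: "balanced CARD('r::finite) L lev"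
  obtains R :: "'r::finite \<Rightarrow> 'n \<Rightarrow> 'n \<Rightarrow> bool"
  where "\<And>i a b. R i a b \<Longrightarrow> lev b = Suc (lev a)"
    and "\<And>i a b b'. R i a b \<Longrightarrow> R i a b' \<Longrightarrow> b = b'"
    and "\<And>i a a' b. R i a b \<Longrightarrow> R i a' b \<Longrightarrow> a = a'"
    and "\<And>b. lev b > 0 \<Longrightarrow> \<exists>i a. R i a b"
    and "\<And>a. lev a < L \<Longrightarrow> \<exists>i b. R i a b"
proof -
  define d where "d l = card {a. lev a = l}" for l
  have "\<exists>h. bij_betw h {a. lev a = l} {0..<d l}" for l
    unfolding d_def by (rule ex_bij_betw_finite_nat) simp
  then obtain h where h: "\<And>l. bij_betw (h l) {a. lev a = l} {0..<d l}"
    by metis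
  \<comment> \<open>Numbers the indices within each level from 0.\<close>
  define idx where "idx a = h (lev a) a" for a
  have idx_less: "idx a < d (lev a)" for a
    using bij_betwE[OF h[of "lev a"]] by (simp add: idx_def)
  have idx_inj: "a = b" if "idx a = idx b" "lev a = lev b" for a b
    using bij_betw_imp_inj_on[OF h[of "lev a"]] that by (auto simp: idx_def inj_on_def)
  have idx_surj: "\<exists>a. lev a = l \<and> idx a = j" if "j < d l" for l j
  proof -
    have "j \<in> h l ` {a. lev a = l}"
      using bij_betw_imp_surj_on[OF h[of l]] that by simp
    then show ?thesis
      by (auto simp: idx_def)
  qed
  obtain k where k: "bij_betw k (UNIV :: 'r set) {0..<CARD('r)}"
    using ex_bij_betw_finite_nat[OF finite_class.finite_UNIV] by blast
  have k_surj: "\<exists>i. k i = j" if "j < CARD('r)" for j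
  proof -
    have "j \<in> range k"
      using bij_betw_imp_surj_on[OF k] that by simp
    then show ?thesis
      by blast
  qed
  obtain i0 where i0: "k i0 = 0"
    using k_surj[of 0] by auto
  have dd: "d l \<le> CARD('r) * d (Suc l)" "d (Suc l) \<le> CARD('r) * d l" if "l < L" for l
    using bal that unfolding balanced_def d_def by auto
  have range: "lev a \<le> L" for a
    using bal unfolding balanced_def by auto
  \<comment> \<open>The quotient selects the arrow, the remainder an index in the smaller
    level.\<close>
  have divmod: "\<exists>i. j = k i * q + j mod q \<and> j mod q < q" if "j < CARD('r) * q" for j q
  proof -
    have "j div q < CARD('r)" "0 < q"
      using that by (auto simp: less_mult_imp_div_less intro: Nat.gr0I)
    then obtain i where "k i = j div q"
      using k_surj by blast
    then show ?thesis
      using \<open>0 < q\<close> by (intro exI[of _ i]) simp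
  qed
  \<comment> \<open>The larger of two adjacent levels is cut into blocks of the size of the smaller,
    and arrow \<open>i\<close> matches block \<open>k i\<close> with it. Balancedness makes the
    available arrows suffice; arrow \<open>i0\<close> serves block 0.\<close>
  define R where "R i a b \<longleftrightarrow> lev b = Suc (lev a) \<and>
     (if d (lev a) \<le> d (lev b) then idx b = k i * d (lev a) + idx a
      else idx a = k i * d (lev b) + idx b)" for i a b
  have "lev b = Suc (lev a)" if "R i a b" for i a b
    using that by (simp add: R_def)
  moreover have "b = b'" if "R i a b" "R i a b'" for i a b b'
    using that by (intro idx_inj) (auto simp: R_def split: if_splits)
  moreover have "a = a'" if "R i a b" "R i a' b" for i a a' b
    using that by (intro idx_inj) (auto simp: R_def split: if_splits)
  moreover have "\<exists>i a. R i a b" if b: "lev b > 0" for b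
  proof -
    obtain l where l: "lev b = Suc l"
      using b gr0_implies_Suc by blast
    have lL: "l < L"
      using range[of b] l by simp
    show ?thesis
    proof (cases "d l \<le> d (Suc l)")
      case True
      have "idx b < CARD('r) * d l"
        using idx_less[of b] dd(2)[OF lL] l by simp
      then obtain i where i: "idx b = k i * d l + idx b mod d l" "idx b mod d l < d l"
        using divmod by blast
      then obtain a where "lev a = l" "idx a = idx b mod d l"
        using idx_surj by blast
      then have "R i a b"
        using i True l by (simp add: R_def)
      then show ?thesis by blast
    next
      case False
      then have "idx b < d l"
        using idx_less[of b] l by simp
      then obtain a where "lev a = l" "idx a = idx b"
        using idx_surj by blast
      then have "R i0 a b"
        using False l i0 by (simp add: R_def)
      then show ?thesis by blast
    qed
  qed
  moreover have "\<exists>i b. R i a b" if a: "lev a < L" for a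
  proof (cases "d (lev a) \<le> d (Suc (lev a))")
    case True
    then have "idx a < d (Suc (lev a))"
      using idx_less[of a] by simp
    then obtain b where "lev b = Suc (lev a)" "idx b = idx a"
      using idx_surj by blast
    then have "R i0 a b"
      using True i0 by (simp add: R_def)
    then show ?thesis by blast
  next
    case False
    have "idx a < CARD('r) * d (Suc (lev a))"
      using idx_less[of a] dd(1)[OF a] by simp
    then obtain i where i: "idx a = k i * d (Suc (lev a)) + idx a mod d (Suc (lev a))"
        "idx a mod d (Suc (lev a)) < d (Suc (lev a))"
      using divmod by blast
    then obtain b where "lev b = Suc (lev a)" "idx b = idx a mod d (Suc (lev a))"
      using idx_surj by blast
    then have "R i a b"
      using i False by (simp add: R_def)
    then show ?thesis by blast
  qed
  ultimately show thesis
    by (rule that)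
qed

text \<open>The coefficient matrices make the test matrix at the 0/1 point the identity:
  \<open>P\<close> supplies the diagonal on positive levels, \<open>Q\<close> on level 0.\<close>

lemma exists_test_matrix_balanced:
  fixes lev :: "'n::finite \<Rightarrow> nat"
  assumes bal: "balanced CARD('r::finite) L lev"
  shows "\<exists>y P Q. y \<in> (graded_orbit lev :: ('k::field^'n^'n^'r::finite) set) \<and> det (test_matrix L P Q y) \<noteq> 0"
proof (rule balanced_matching[OF bal])
  fix R :: "'r \<Rightarrow> 'n \<Rightarrow> 'n \<Rightarrow> bool"
  assume R_lev: "\<And>i a b. R i a b \<Longrightarrow> lev b = Suc (lev a)"
    and R_right: "\<And>i a b b'. R i a b \<Longrightarrow> R i a b' \<Longrightarrow> b = b'"
    and R_left: "\<And>i a a' b. R i a b \<Longrightarrow> R i a' b \<Longrightarrow> a = a'"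
    and R_in: "\<And>b. lev b > 0 \<Longrightarrow> \<exists>i a. R i a b"
    and R_out: "\<And>a. lev a < L \<Longrightarrow> \<exists>i b. R i a b"
  define y :: "'k^'n^'n^'r" where "y = (\<chi> i b a. if R i a b then 1 else 0)"
  have y: "y $ i $ b $ a = (if R i a b then 1 else 0)" for i a b
    by (simp add: y_def)
  have "y \<in> graded lev"
    unfolding graded_def using R_lev by (simp add: y)
  moreover have "y = conjugate (mat 1) (mat 1) y"
    by (simp add: conjugate_def vec_eq_iff)
  ultimately have orbit: "y \<in> graded_orbit lev"
    unfolding graded_orbit_def by (metis (mono_tags, lifting) matrix_mul_lid mem_Collect_eq)

  obtain arr par where arr: "\<And>b. lev b > 0 \<Longrightarrow> R (arr b) (par b) b"
    using R_in by metis
  \<comment> \<open>For \<open>b\<close> of positive level, column \<open>b\<close> of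
    \<open>P (arr b)\<close> is the basis vector \<open>par b\<close>, which arrow
    \<open>arr b\<close> sends to \<open>b\<close>.\<close>
  define P :: "'r \<Rightarrow> 'k^'n^'n" where
    "P i = (\<chi> a b. if lev b > 0 \<and> i = arr b \<and> a = par b then 1 else 0)" for i
  have "(y $ i ** P i) $ c $ b = (if i = arr b then (if lev b > 0 \<and> c = b then 1 else 0) else 0)" for i b c
  proof -
    have "(y $ i ** P i) $ c $ b = (\<Sum>a\<in>UNIV. if a = par b then (if lev b > 0 \<and> i = arr b then y $ i $ c $ a else 0) else 0)"
      unfolding matrix_matrix_mult_def P_def vec_lambda_beta by (rule sum.cong) auto
    also have "\<dots> = (if lev b > 0 \<and> i = arr b then y $ i $ c $ par b else 0)"
      by (simp add: sum.delta)
    also have "\<dots> = (if i = arr b then (if lev b > 0 \<and> c = b then 1 else 0) else 0)"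
      using arr[of b] R_right[of i "par b" c b] by (auto simp: y)
    finally show ?thesis .
  qed
  then have P: "(\<Sum>i\<in>UNIV. y $ i ** P i) $ c $ b = (if lev b > 0 \<and> c = b then 1 else 0)" for b c
    by (simp add: sum.delta)

  \<comment> \<open>Following outgoing links makes some row of a path matrix the coordinate form of
    \<open>a\<close>; the new arrow ends the word because it acts first. Level 0 leaves room for
    \<open>L\<close> arrows.\<close>
  have "\<exists>w e. length w = m \<and> (\<forall>c. path_matrix y (Path w) $ e $ c = (if c = a then 1 else 0))"
    if "lev a + m \<le> L" for a m
    using that
  proof (induction m arbitrary: a)
    case 0
    show ?case
      by (rule exI[of _ "[]"], rule exI[of _ a]) (simp add: mat_def)
  next
    case (Suc m)
    then obtain i b where ib: "R i a b"
      using R_out[of a] by auto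
    then have "lev b + m \<le> L"
      using R_lev Suc.prems by fastforce
    then obtain w e where w: "length w = m" "\<And>c. path_matrix y (Path w) $ e $ c = (if c = b then 1 else 0)"
      using Suc.IH by blast
    have "path_matrix y (Path (w @ [i])) = path_matrix y (Path w) ** y $ i"
      using path_matrix_add[of y "Path w" "Path [i]"] by (simp add: plus_quiver_path_def path_matrix_Cons)
    then have "path_matrix y (Path (w @ [i])) $ e $ c = y $ i $ b $ c" for c
      by (simp add: matrix_matrix_mult_def w(2) if_distrib[where f = "\<lambda>t. t * _"] sum.delta cong: if_cong)
    also have "y $ i $ b $ c = (if c = a then 1 else 0)" for c
      using ib R_left by (auto simp: y)
    finally show ?case
      using w(1) by (intro exI[of _ "w @ [i]"] exI[of _ e]) simp
  qed
  then have "\<exists>w e. lev a = 0 \<longrightarrow> length w = L \<and> (\<forall>c. path_matrix y (Path w) $ e $ c = (if c = a then 1 else 0))" for a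
    by (metis add_0 le_refl)
  then obtain W E where W: "\<And>a. lev a = 0 \<Longrightarrow> length (W a) = L"
    "\<And>a c. lev a = 0 \<Longrightarrow> path_matrix y (Path (W a)) $ E a $ c = (if c = a then 1 else 0)"
    by metis
  \<comment> \<open>For \<open>a\<close> of level 0, row \<open>a\<close> of \<open>Q (W a)\<close>
    selects the row that is this coordinate form.\<close>
  define Q :: "'r list \<Rightarrow> 'k^'n^'n" where
    "Q w = (\<chi> a e. if lev a = 0 \<and> w = W a \<and> e = E a then 1 else 0)" for w
  have "(Q w ** path_matrix y (Path w)) $ a $ c = (if w = W a then (if lev a = 0 \<and> a = c then 1 else 0) else 0)" for w a c
  proof -
    have "(Q w ** path_matrix y (Path w)) $ a $ c =
        (\<Sum>e\<in>UNIV. if e = E a then (if lev a = 0 \<and> w = W a then path_matrix y (Path w) $ e $ c else 0) else 0)"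
      unfolding matrix_matrix_mult_def Q_def vec_lambda_beta by (rule sum.cong) auto
    also have "\<dots> = (if lev a = 0 \<and> w = W a then path_matrix y (Path w) $ E a $ c else 0)"
      by (simp add: sum.delta)
    also have "\<dots> = (if w = W a then (if lev a = 0 \<and> a = c then 1 else 0) else 0)"
      using W(2)[of a c] by auto
    finally show ?thesis .
  qed
  then have Q: "(\<Sum>w | length w = L. Q w ** path_matrix y (Path w)) $ a $ c = (if lev a = 0 \<and> a = c then 1 else 0)" for a c
    using W(1)[of a] by (auto simp: sum.delta finite_words)
  have "test_matrix L P Q y = mat 1"
    unfolding test_matrix_def by (simp add: vec_eq_iff P[simplified] Q[simplified] mat_def)
  then show ?thesis
    using orbit by (intro exI[of _ y] exI[of _ P] exI[of _ Q]) simp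
qed

section \<open>Balanced orbits and irreducible components\<close>

lemma finite_balanced: "finite {lev :: 'n::finite \<Rightarrow> nat. balanced r L lev}"
proof (rule finite_subset)
  show "{lev :: 'n \<Rightarrow> nat. balanced r L lev} \<subseteq> (UNIV :: 'n set) \<rightarrow>\<^sub>E {..L}"
    unfolding balanced_def by (auto simp: PiE_def)
  show "finite ((UNIV :: 'n set) \<rightarrow>\<^sub>E {..L})"
    by (intro finite_PiE) auto
qed

text \<open>Finitely many irreducible balanced orbits cover the representation variety, so one lies
  entirely in the component, and with it the 0/1 point.\<close>

lemma component_test_matrix:
  fixes C :: "('k::alg_closed_field^'n^'n^'r) set"
  assumes r: "CARD('r) \<ge> 2" and n: "CARD('n) > L"
    and C: "irreducible_component (subtopology zariski (rep_variety L)) C"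
  shows "\<exists>z P Q. z \<in> C \<and> det (test_matrix L P Q z) \<noteq> 0"
proof -
  have "C \<subseteq> rep_variety L"
    using C by (auto simp: irreducible_component_def irreducible_in_def)
  then have "C \<subseteq> (\<Union>lev\<in>{lev. balanced CARD('r) L lev}. graded_orbit lev)"
    using exists_balanced_orbit[OF _ r, of _ L] n by fastforce
  moreover have "irreducible_in (subtopology zariski (rep_variety L)) (graded_orbit lev :: ('k^'n^'n^'r) set)"
    if "lev \<in> {lev. balanced CARD('r) L lev}" for lev
    using that by (intro irreducible_graded_orbit graded_orbit_subset_rep_variety) (auto simp: balanced_def)
  ultimately obtain lev where "balanced CARD('r) L lev" "graded_orbit lev \<subseteq> C"
    using irreducible_component_family[OF C finite_balanced, of "CARD('r)" L graded_orbit] by auto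
  then show ?thesis
    using exists_test_matrix_balanced by blast
qed

theorem corollaryD:
  fixes C :: "('k::alg_closed_field^'n^'n^'r) set" and L :: nat
  assumes "CARD('r) \<ge> 2" and "L \<ge> 1" and "CARD('n) > L + 1"
    and "irreducible_component (subtopology zariski (rep_variety L)) C"
  shows "generically C (\<lambda>x. \<forall>v. v \<notin> ideal_smult x (rad L) UNIV \<longrightarrow>
            (\<lambda>a. act x a v) ` rad_power L L \<noteq> {0})
    \<and> generically C (\<lambda>x. \<exists>k N. decomposition L x k N \<and>
            (\<forall>i<k. indecomposable L x (N i) \<and> loewy_length L x (N i) = L + 1))"
proof -
  \<comment> \<open>A single determinant, nonzero at \<open>z\<close>, serves both generic
    statements.\<close>
  obtain z P Q where z: "z \<in> C" "det (test_matrix L P Q z) \<noteq> 0"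
    using component_test_matrix[OF assms(1) _ assms(4)] assms(3) by auto
  show ?thesis
  proof (intro conjI; rule generically_test_matrix[OF assms(4) z])
    fix x :: "'k^'n^'n^'r"
    assume x: "x \<in> rep_variety L" "det (test_matrix L P Q x) \<noteq> 0"
    note full = test_matrix_radical_part[OF x]
    show "\<forall>v. v \<notin> ideal_smult x (rad L) UNIV \<longrightarrow> (\<lambda>a. act x a v) ` rad_power L L \<noteq> {0}"
      using full radical_part_le[OF x(1)] rad_power_image_nonzero[OF x(1)] by (metis subsetD)
    show "\<exists>k N. decomposition L x k N \<and>
            (\<forall>i<k. indecomposable L x (N i) \<and> loewy_length L x (N i) = L + 1)"
      by (rule exists_decomposition_loewy_length[OF x(1) full])
  qed
qed

end
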